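(* Let $T$ be the torus. The candidate surface branched covers inducing a candidate 2-orbifold cover $\widetilde X\dashrightarrow X$ with $\widetilde X=T$ (no cone points) are the following, with arbitrary $k\geq 1$: \begin{itemize} \item $\widetilde\Sigma=\Sigma=T$, $d=k$, no partitions (unbranched); \item $\widetilde\Sigma=T$, $\Sigma=S$, $d=2k$, partitions $(2^k),(2^k),(2^k),(2^k)$; \item $\widetilde\Sigma=T$, $\Sigma=S$, $d=3k$, partitions $(3^k),(3^k),(3^k)$; \item $\widetilde\Sigma=T$, $\Sigma=S$, $d=4k$, partitions $(2^{2k}),(4^k),(4^k)$; \item $\widetilde\Sigma=T$, $\Sigma=S$, $d=6k$, partitions $(2^{3k}),(3^{2k}),(6^k)$. \end{itemize} All of them are realizable.
   Context: $S$ is the 2-sphere. A partition of $d$ is a finite unordered list (multiset) of positive integers with sum $d$; $\ell(\Pi)$ is the number of entries of $\Pi$; $(a^m,b,\ldots)$ means that $a$ is repeated $m$ times. For closed connected orientable surfaces $\widetilde\Sigma,\Sigma$, a branched cover $f:\widetilde\Sigma\to\Sigma$ is a map locally modelled on $(\mathbb{C},0)\to(\mathbb{C},0)$, $z\mapsto z^k$ with $k\geq 1$; $k$ is the local degree at the source point, and a point of $\Sigma$ having a preimage with local degree $>1$ is a branching point. The degree $d$ of $f$ is the degree of the genuine cover obtained by removing the branching points and their preimages; the local degrees at the preimages of a branching point form a partition of $d$. A candidate surface branched cover consists of closed connected orientable surfaces $\widetilde\Sigma,\Sigma$ (up to homeomorphism), integers $d\geq 1$ and $n\geq 0$, and an unordered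 collection (repetitions allowed) $\Pi_1,\ldots,\Pi_n$ of partitions of $d$, each with at least one entry $>1$, satisfying the Riemann-Hurwitz condition $\chi(\widetilde\Sigma)-\sum_i\ell(\Pi_i)=d\,(\chi(\Sigma)-n)$. It is realizable if there is a degree-$d$ branched cover $f:\widetilde\Sigma\to\Sigma$ with $n$ branching points whose associated partitions of local degrees are $\Pi_1,\ldots,\Pi_n$. A 2-orbifold $\Sigma(p_1,\ldots,p_n)$ is a closed connected orientable surface $\Sigma$ with $n$ cone points of orders $p_i\geq 2$. With $\Pi_i=(d_{ij})_j$, set $p_i=\mathrm{lcm}_j\, d_{ij}$ and $p_{ij}=p_i/d_{ij}$. The induced candidate 2-orbifold cover is $\widetilde X\dashrightarrow X$ with $X=\Sigma(p_1,\ldots,p_n)$ and $\widetilde X=\widetilde\Sigma((p_{ij})_{i,j})$, where orders equal to $1$ are dropped. *)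

theory Defs
  imports "HOL-Analysis.Analysis" "HOL-Library.Multiset"
begin

text \<open>Closed connected orientable surfaces are considered up to homeomorphism, hence
  they are recorded by their genus.  The surface of genus \<open>g\<close> is realized in
  \<open>\<complex> \<times> \<real>\<close> as the double of a disc with \<open>g\<close> holes: for the disc of radius
  \<open>3 * g + 1\<close> around \<open>0\<close> with the disjoint unit discs around \<open>0, 3, \<dots>, 3 * (g - 1)\<close>
  removed, the right-hand side of the equation is nonnegative exactly on the holed disc and
  vanishes exactly on its boundary.  For \<open>g = 0\<close> this is the unit sphere and for \<open>g = 1\<close>
  it is a torus, see the two lemmas below.\<close>

definition genus_surface :: "nat \<Rightarrow> (complex \<times> real) set" where
  "genus_surface g =
     {(z, t). t\<^sup>2 = ((3 * real g + 1)\<^sup>2 - (cmod z)\<^sup>2) *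
                    (\<Prod>i<g. (cmod (z - of_nat (3 * i)))\<^sup>2 - 1)}"

lemma genus_surface_0: "genus_surface 0 = sphere 0 1"
proof -
  have "t\<^sup>2 = 1 - (cmod z)\<^sup>2 \<longleftrightarrow> sqrt ((cmod z)\<^sup>2 + t\<^sup>2) = 1" for z :: complex and t :: real
    by (auto simp: algebra_simps)
  then show ?thesis
    by (auto simp: genus_surface_def norm_prod_def)
qed

lemma genus_surface_1:
  "genus_surface 1 homeomorphic (sphere 0 1 :: complex set) \<times> (sphere 0 1 :: complex set)"
proof -
  note One_nat_def [simp del]
  let ?T = "(sphere 0 1 :: complex set) \<times> (sphere 0 1 :: complex set)"
  define h :: "complex \<times> real \<Rightarrow> complex \<times> complex" where
    "h = (\<lambda>p. (fst p / of_real (cmod (fst p)),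
               Complex (((cmod (fst p))\<^sup>2 - 17/2) / (15/2)) (snd p / (15/2))))"
  define h' :: "complex \<times> complex \<Rightarrow> complex \<times> real" where
    "h' = (\<lambda>q. (of_real (sqrt (15/2 * Re (snd q) + 17/2)) * fst q, 15/2 * Im (snd q)))"
  have S: "genus_surface 1 = {(z, t). t\<^sup>2 = (16 - (cmod z)\<^sup>2) * ((cmod z)\<^sup>2 - 1)}"
    by (simp add: genus_surface_def)
  have ge1: "1 \<le> (cmod z)\<^sup>2" if "(z, t) \<in> genus_surface 1" for z t
  proof (rule ccontr)
    assume "\<not> 1 \<le> (cmod z)\<^sup>2"
    then have "(16 - (cmod z)\<^sup>2) * ((cmod z)\<^sup>2 - 1) < 0"
      by (intro mult_pos_neg) auto
    with that show False
      using zero_le_power2[of t] by (simp add: S)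
  qed
  have nz: "z \<noteq> 0" if "(z, t) \<in> genus_surface 1" for z t
    using ge1[OF that] by auto
  have pos: "1 \<le> 15/2 * Re w + 17/2" if "cmod w = 1" for w
    using abs_Re_le_cmod[of w] that by simp
  have "homeomorphism (genus_surface 1) ?T h h'"
  proof (rule homeomorphismI)
    show "continuous_on (genus_surface 1) h"
      unfolding h_def Complex_eq using nz
      by (auto intro!: continuous_intros)
    show "continuous_on ?T h'"
      unfolding h'_def by (auto intro!: continuous_intros)
    show "h ` genus_surface 1 \<subseteq> ?T"
    proof (rule image_subsetI)
      fix p
      assume "p \<in> genus_surface 1"
      then obtain z t where p: "p = (z, t)" and zt: "(z, t) \<in> genus_surface 1"
        by (cases p) auto
      then have "t\<^sup>2 = (16 - (cmod z)\<^sup>2) * ((cmod z)\<^sup>2 - 1)"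
        by (simp add: S)
      then have "(((cmod z)\<^sup>2 - 17/2) / (15/2))\<^sup>2 + (t / (15/2))\<^sup>2 = 1"
        unfolding power_divide by (simp add: field_simps power2_eq_square)
      then show "h p \<in> ?T"
        using nz[OF zt] by (simp add: p h_def norm_divide complex_norm)
    qed
    show "h' ` ?T \<subseteq> genus_surface 1"
    proof (rule image_subsetI)
      fix q
      assume "q \<in> ?T"
      then obtain v w where q: "q = (v, w)" and vw: "cmod v = 1" "cmod w = 1"
        by auto
      then have w: "(Re w)\<^sup>2 + (Im w)\<^sup>2 = 1"
        using cmod_power2[of w] by simp
      have "(cmod (of_real (sqrt (15/2 * Re w + 17/2)) * v))\<^sup>2 = 15/2 * Re w + 17/2"
        using pos[OF vw(2)] by (simp add: norm_mult vw)
      moreover have "(15/2 * Im w)\<^sup>2 = (16 - (15/2 * Re w + 17/2)) * ((15/2 * Re w + 17/2) - 1)"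
        using w by (simp add: power2_eq_square algebra_simps)
      ultimately show "h' q \<in> genus_surface 1"
        by (simp add: q S h'_def)
    qed
    show "h' (h p) = p" if "p \<in> genus_surface 1" for p
    proof -
      have "15/2 * (((cmod (fst p))\<^sup>2 - 17/2) / (15/2)) + 17/2 = (cmod (fst p))\<^sup>2"
        by (simp add: field_simps)
      then have "sqrt (15/2 * (((cmod (fst p))\<^sup>2 - 17/2) / (15/2)) + 17/2) = cmod (fst p)"
        by (simp only: real_sqrt_abs abs_norm_cancel)
      then have "fst (h' (h p)) = of_real (cmod (fst p)) * (fst p / of_real (cmod (fst p)))"
        by (simp only: h_def h'_def fst_conv snd_conv complex.sel)
      then show ?thesis
        using that nz[of "fst p" "snd p"] by (simp add: h_def h'_def prod_eq_iff)
    qed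
    show "h (h' q) = q" if q_in: "q \<in> ?T" for q
    proof -
      obtain v w where q: "q = (v, w)" "cmod v = 1" "cmod w = 1"
        using q_in by auto
      have "0 < 15/2 * Re w + 17/2"
        using pos[OF q(3)] by simp
      then have "0 < 15 * Re w / 2 + 17 / 2"
        by simp
      then show ?thesis
        by (simp add: q h_def h'_def norm_mult complex_eq_iff)
    qed
  qed
  then show ?thesis
    by (auto simp: homeomorphic_def)
qed

definition euler_char :: "nat \<Rightarrow> int" where
  "euler_char g = 2 - 2 * int g"

definition power_model_at ::
  "'a::topological_space set \<Rightarrow> 'b::topological_space set \<Rightarrow> ('a \<Rightarrow> 'b) \<Rightarrow> 'a \<Rightarrow> nat \<Rightarrow> bool" where
  "power_model_at S T f x k \<longleftrightarrow> 1 \<le> k \<and>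
     (\<exists>U V A B (\<phi> :: 'a \<Rightarrow> complex) \<phi>' (\<psi> :: 'b \<Rightarrow> complex) \<psi>'.
        openin (top_of_set S) U \<and> x \<in> U \<and> openin (top_of_set T) V \<and> f ` U \<subseteq> V \<and>
        open A \<and> open B \<and> homeomorphism U A \<phi> \<phi>' \<and> homeomorphism V B \<psi> \<psi>' \<and>
        \<phi> x = 0 \<and> \<psi> (f x) = 0 \<and> (\<forall>u\<in>U. \<psi> (f u) = \<phi> u ^ k))"

lemma power_model_fibers:
  fixes \<phi> :: "'a::topological_space \<Rightarrow> complex" and \<psi> :: "'b::topological_space \<Rightarrow> complex"
  assumes k: "1 \<le> k" and U: "openin (top_of_set S) U" "x \<in> U"
    and V: "openin (top_of_set T) V" "f ` U \<subseteq> V"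
    and AB: "open A" "open B" and hom: "homeomorphism U A \<phi> \<phi>'" "homeomorphism V B \<psi> \<psi>'"
    and z: "\<phi> x = 0" "\<psi> (f x) = 0" and pow: "\<forall>u\<in>U. \<psi> (f u) = \<phi> u ^ k"
    and W: "openin (top_of_set S) W" "x \<in> W"
  shows "\<exists>e>0. \<forall>y\<in>V. y \<noteq> f x \<longrightarrow> \<psi> y \<in> ball 0 e \<longrightarrow>
           {u \<in> U. f u = y} \<subseteq> W \<and> card {u \<in> U. f u = y} = k"
proof -
  have "openin (top_of_set U) (W \<inter> U)"
    using W U openin_subset_trans[of S "W \<inter> U" U] openin_imp_subset[OF U(1)]
    by (auto intro: openin_Int)
  then have "openin (top_of_set A) (\<phi> ` (W \<inter> U))"
    using homeomorphism_imp_open_map[OF hom(1)] by blast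
  then have op: "open (\<phi> ` (W \<inter> U))"
    using AB(1) by (simp add: openin_open_eq)
  have "0 \<in> \<phi> ` (W \<inter> U)"
    using U W z by force
  then obtain r where r: "r > 0" "ball 0 r \<subseteq> \<phi> ` (W \<inter> U)"
    using op openE by blast
  show ?thesis
  proof (intro exI[of _ "r ^ k"] conjI ballI impI)
    show "0 < r ^ k"
      using r by simp
    fix y
    assume y: "y \<in> V" "y \<noteq> f x" "\<psi> y \<in> ball 0 (r ^ k)"
    have inj: "inj_on \<psi> V" "inj_on \<phi> U"
      using hom by (metis homeomorphism_def inj_on_inverseI)+
    have "f x \<in> V"
      using U V by auto
    then have nz: "\<psi> y \<noteq> 0"
      using y z inj_onD[OF inj(1), of y "f x"] by auto
    have small: "v \<in> \<phi> ` (W \<inter> U)" if "v ^ k = \<psi> y" for v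
    proof -
      have "cmod v ^ k < r ^ k"
        using y that by (metis mem_ball_0 norm_power)
      then have "cmod v < r"
        using r by (meson less_eq_real_def power_less_imp_less_base)
      then show ?thesis
        using r by auto
    qed
    have sub: "{u \<in> U. f u = y} \<subseteq> W"
    proof clarify
      fix u
      assume u: "u \<in> U" "y = f u"
      then have "\<phi> u \<in> \<phi> ` (W \<inter> U)"
        using pow by (intro small) auto
      then show "u \<in> W"
        using inj u by (auto dest: inj_onD)
    qed
    have "bij_betw \<phi> {u \<in> U. f u = y} {v. v ^ k = \<psi> y}"
      unfolding bij_betw_def
    proof
      show "inj_on \<phi> {u \<in> U. f u = y}"
        using inj by (auto intro: inj_on_subset)
      show "\<phi> ` {u \<in> U. f u = y} = {v. v ^ k = \<psi> y}"
      proof (intro equalityI subsetI)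
        fix v
        assume v: "v \<in> {v. v ^ k = \<psi> y}"
        then obtain u where u: "u \<in> U" "v = \<phi> u"
          using small[of v] by auto
        then have "\<psi> (f u) = \<psi> y"
          using pow v by auto
        then have "f u = y"
          using inj y u V by (meson image_subset_iff inj_onD)
        then show "v \<in> \<phi> ` {u \<in> U. f u = y}"
          using u by auto
      qed (use pow in auto)
    qed
    then have "card {u \<in> U. f u = y} = card {v. v ^ k = \<psi> y}"
      by (rule bij_betw_same_card)
    also have "\<dots> = k"
      using k nz by (intro card_nth_roots) auto
    finally show "card {u \<in> U. f u = y} = k" .
    show "{u \<in> U. f u = y} \<subseteq> W"
      by (fact sub)
  qed
qed

lemma power_model_at_unique:
  assumes "power_model_at S T f x k" "power_model_at S T f x l"
  shows "k = l"
proof -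
  obtain U V A B and \<phi> :: "_ \<Rightarrow> complex" and \<phi>' and \<psi> :: "_ \<Rightarrow> complex" and \<psi>' where
    1: "1 \<le> k" "openin (top_of_set S) U" "x \<in> U" "openin (top_of_set T) V" "f ` U \<subseteq> V"
       "open A" "open B" "homeomorphism U A \<phi> \<phi>'" "homeomorphism V B \<psi> \<psi>'"
       "\<phi> x = 0" "\<psi> (f x) = 0" "\<forall>u\<in>U. \<psi> (f u) = \<phi> u ^ k"
    using assms(1) unfolding power_model_at_def by blast
  obtain U2 V2 A2 B2 and \<phi>2 :: "_ \<Rightarrow> complex" and \<phi>2' and \<psi>2 :: "_ \<Rightarrow> complex" and \<psi>2' where
    2: "1 \<le> l" "openin (top_of_set S) U2" "x \<in> U2" "openin (top_of_set T) V2" "f ` U2 \<subseteq> V2"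
       "open A2" "open B2" "homeomorphism U2 A2 \<phi>2 \<phi>2'" "homeomorphism V2 B2 \<psi>2 \<psi>2'"
       "\<phi>2 x = 0" "\<psi>2 (f x) = 0" "\<forall>u\<in>U2. \<psi>2 (f u) = \<phi>2 u ^ l"
    using assms(2) unfolding power_model_at_def by blast
  obtain e where e: "e > 0" "\<And>y. \<lbrakk>y \<in> V; y \<noteq> f x; \<psi> y \<in> ball 0 e\<rbrakk> \<Longrightarrow>
      {u \<in> U. f u = y} \<subseteq> U2 \<and> card {u \<in> U. f u = y} = k"
    using power_model_fibers[OF 1 2(2,3)] by blast
  obtain e2 where e2: "e2 > 0" "\<And>y. \<lbrakk>y \<in> V2; y \<noteq> f x; \<psi>2 y \<in> ball 0 e2\<rbrakk> \<Longrightarrow>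
      {u \<in> U2. f u = y} \<subseteq> U \<and> card {u \<in> U2. f u = y} = l"
    using power_model_fibers[OF 2 1(2,3)] by blast
  have fx: "f x \<in> V" "f x \<in> V2"
    using 1 2 by auto
  have cont: "continuous_on V2 \<psi>2" "continuous_on B \<psi>'"
    using 1(9) 2(9) by (auto simp: homeomorphism_def)
  have inv: "\<psi>' ` B = V" "\<And>b. b \<in> B \<Longrightarrow> \<psi> (\<psi>' b) = b" "\<And>y. y \<in> V \<Longrightarrow> \<psi>' (\<psi> y) = y" "\<psi> ` V = B"
    using 1(9) by (auto simp: homeomorphism_def)
  define N where "N = V2 \<inter> \<psi>2 -` ball 0 e2"
  have "openin (top_of_set V2) N"
    unfolding N_def by (rule continuous_openin_preimage_gen[OF cont(1)]) simp
  then have "openin (top_of_set T) N"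
    using 2(4) openin_trans by blast
  then have "openin (top_of_set V) (V \<inter> N)"
    using openin_subset_trans[of T "V \<inter> N" V] openin_imp_subset[OF 1(4)] 1(4)
    by (auto intro: openin_Int)
  then have "openin (top_of_set B) (\<psi> ` (V \<inter> N))"
    using homeomorphism_imp_open_map[OF 1(9)] by blast
  then have op: "open (\<psi> ` (V \<inter> N) \<inter> ball 0 e)"
    using 1(7) by (simp add: openin_open_eq open_Int)
  have "f x \<in> N"
    using fx 2(11) e2(1) by (simp add: N_def)
  then have "0 \<in> \<psi> ` (V \<inter> N)"
    using fx 1(11) by (metis IntI imageI)
  then have "0 \<in> \<psi> ` (V \<inter> N) \<inter> ball 0 e"
    using e(1) by simp
  then obtain b where b: "b \<in> \<psi> ` (V \<inter> N) \<inter> ball 0 e" "b \<noteq> 0"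
    using op not_open_singleton[of "0::complex"] by (metis equals0D insert_iff subsetI subset_singletonD)
  then obtain y where y: "y \<in> V" "y \<in> N" "\<psi> y \<in> ball 0 e" "\<psi> y \<noteq> 0"
    by auto
  have "y \<noteq> f x"
    using y(4) 1(11) by auto
  with y e(2)[of y] e2(2)[of y] have
    "{u \<in> U. f u = y} \<subseteq> U2 \<and> card {u \<in> U. f u = y} = k"
    "{u \<in> U2. f u = y} \<subseteq> U \<and> card {u \<in> U2. f u = y} = l"
    by (auto simp: N_def)
  moreover from this have "{u \<in> U. f u = y} = {u \<in> U2. f u = y}"
    by blast
  ultimately show ?thesis
    by simp
qed

definition branched_cover ::
  "'a::topological_space set \<Rightarrow> 'b::topological_space set \<Rightarrow> ('a \<Rightarrow> 'b) \<Rightarrow> bool" where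
  "branched_cover S T f \<longleftrightarrow> f ` S \<subseteq> T \<and> (\<forall>x\<in>S. \<exists>k. power_model_at S T f x k)"

definition local_degree ::
  "'a::topological_space set \<Rightarrow> 'b::topological_space set \<Rightarrow> ('a \<Rightarrow> 'b) \<Rightarrow> 'a \<Rightarrow> nat" where
  "local_degree S T f x = (THE k. power_model_at S T f x k)"

lemma local_degree_eq: "power_model_at S T f x k \<Longrightarrow> local_degree S T f x = k"
  unfolding local_degree_def using power_model_at_unique by blast

definition branching_points ::
  "'a::topological_space set \<Rightarrow> 'b::topological_space set \<Rightarrow> ('a \<Rightarrow> 'b) \<Rightarrow> 'b set" where
  "branching_points S T f = {y \<in> T. \<exists>x\<in>S. f x = y \<and> local_degree S T f x > 1}"

text \<open>For a branched cover of closed surfaces, the restriction of \<open>f\<close> over the complement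
  of the (finitely many) branching points is a genuine cover; its degree is the number of its
  sheets.\<close>

definition has_cover_degree ::
  "'a::topological_space set \<Rightarrow> 'b::topological_space set \<Rightarrow> ('a \<Rightarrow> 'b) \<Rightarrow> nat \<Rightarrow> bool" where
  "has_cover_degree S T f d \<longleftrightarrow>
     (\<forall>y \<in> T - branching_points S T f.
        finite {x \<in> S. f x = y} \<and> card {x \<in> S. f x = y} = d)"

definition local_degrees_over ::
  "'a::topological_space set \<Rightarrow> 'b::topological_space set \<Rightarrow> ('a \<Rightarrow> 'b) \<Rightarrow> 'b \<Rightarrow> nat multiset" where
  "local_degrees_over S T f y = image_mset (local_degree S T f) (mset_set {x \<in> S. f x = y})"

definition is_partition_of :: "nat \<Rightarrow> nat multiset \<Rightarrow> bool" where
  "is_partition_of d P \<longleftrightarrow> (\<forall>m \<in># P. 1 \<le> m) \<and> sum_mset P = d"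

text \<open>The number \<open>n\<close> of partitions is \<open>size (partitions c)\<close>, and the length of a
  partition is its size as a multiset.\<close>

record cover_data =
  source_genus :: nat
  target_genus :: nat
  cover_degree :: nat
  partitions :: "nat multiset multiset"

definition candidate_branched_cover :: "cover_data \<Rightarrow> bool" where
  "candidate_branched_cover c \<longleftrightarrow>
     1 \<le> cover_degree c \<and>
     (\<forall>P \<in># partitions c. is_partition_of (cover_degree c) P \<and> (\<exists>m \<in># P. m > 1)) \<and>
     euler_char (source_genus c) - (\<Sum>P \<in># partitions c. int (size P)) =
       int (cover_degree c) * (euler_char (target_genus c) - int (size (partitions c)))"

definition realizable :: "cover_data \<Rightarrow> bool" where
  "realizable c \<longleftrightarrow>
     (let S = genus_surface (source_genus c); T = genus_surface (target_genus c)
      in \<exists>f. branched_cover S T f \<and> has_cover_degree S T f (cover_degree c) \<and>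
             finite (branching_points S T f) \<and>
             image_mset (local_degrees_over S T f) (mset_set (branching_points S T f)) =
               partitions c)"

record orbifold2 =
  underlying_genus :: nat
  cone_orders :: "nat multiset"

definition torus_orbifold :: orbifold2 where
  "torus_orbifold = \<lparr>underlying_genus = 1, cone_orders = {#}\<rparr>"

definition partition_lcm :: "nat multiset \<Rightarrow> nat" where
  "partition_lcm P = Lcm (set_mset P)"

definition induced_source_orbifold :: "cover_data \<Rightarrow> orbifold2" where
  "induced_source_orbifold c =
     \<lparr>underlying_genus = source_genus c,
      cone_orders =
        filter_mset (\<lambda>p. p \<noteq> 1)
          (\<Sum>P \<in># partitions c. image_mset (\<lambda>m. partition_lcm P div m) P)\<rparr>"

definition induced_target_orbifold :: "cover_data \<Rightarrow> orbifold2" where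
  "induced_target_orbifold c =
     \<lparr>underlying_genus = target_genus c, cone_orders = image_mset partition_lcm (partitions c)\<rparr>"

text \<open>The first component is the covering orbifold, the second one the covered orbifold.\<close>

definition induced_orbifold_cover :: "cover_data \<Rightarrow> orbifold2 \<times> orbifold2" where
  "induced_orbifold_cover c = (induced_source_orbifold c, induced_target_orbifold c)"

definition torus_covers :: "cover_data set" where
  "torus_covers = (\<Union>k\<in>{1::nat..}.
    {\<lparr>source_genus = 1, target_genus = 1, cover_degree = k, partitions = {#}\<rparr>,
     \<lparr>source_genus = 1, target_genus = 0, cover_degree = 2 * k, partitions =
       {#replicate_mset k 2, replicate_mset k 2, replicate_mset k 2, replicate_mset k 2#}\<rparr>,
     \<lparr>source_genus = 1, target_genus = 0, cover_degree = 3 * k, partitions =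
       {#replicate_mset k 3, replicate_mset k 3, replicate_mset k 3#}\<rparr>,
     \<lparr>source_genus = 1, target_genus = 0, cover_degree = 4 * k, partitions =
       {#replicate_mset (2 * k) 2, replicate_mset k 4, replicate_mset k 4#}\<rparr>,
     \<lparr>source_genus = 1, target_genus = 0, cover_degree = 6 * k, partitions =
       {#replicate_mset (3 * k) 2, replicate_mset (2 * k) 3, replicate_mset k 6#}\<rparr>})"

end

theory Submission
  imports Defs "HOL-Complex_Analysis.Conformal_Mappings"
begin

text \<open>If the covering orbifold has no cone points, then every partition is constant, and the
  Riemann-Hurwitz condition reduces to \<open>\<Sum>(1 - 1 / p\<^sub>i) = 2 - 2 g\<close>, whose solutions are the listed ones.

  For realizability, let \<open>\<Lambda> = \<int> + \<int> \<tau>\<close> be a lattice invariant under the group of \<open>m\<close>-th roots of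
  unity, and let \<open>\<Gamma>\<close> be the group of the maps \<open>z \<mapsto> \<zeta> z + l\<close>.  Every continuous map \<open>F\<close> of \<open>\<complex>\<close> onto a
  surface whose fibres are the \<open>\<Gamma>\<close>-orbits is open, and at \<open>c\<close> it looks like the quotient by the
  stabilizer of \<open>c\<close>, that is, like \<open>z \<mapsto> z ^ e\<close>.  Hence \<open>F\<close> induces a branched cover of degree \<open>k m\<close>
  from the torus \<open>\<complex> / (k \<int> + \<int> \<tau>)\<close>.  It remains to give \<open>F\<close> explicitly.  For \<open>m = 2\<close> one takes
  \<open>(cos a, cos b, sin a sin b)\<close>, whose image \<open>t\<^sup>2 = (1 - x\<^sup>2) (1 - y\<^sup>2)\<close> is star-shaped.  For \<open>m = 3\<close> the
  torus is the one of unit triples \<open>e\<^sub>1 e\<^sub>2 e\<^sub>3 = 1\<close>, with cyclic permutations acting, and one takes their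
  sum and Vandermonde determinant; by the discriminant formula the image is again star-shaped.  The
  cases \<open>m = 4\<close> and \<open>m = 6\<close> follow by composing with the quotient of the sphere by a half turn.\<close>

section \<open>Classification\<close>

text \<open>Realizability concerns maps between concrete subsets of Euclidean space, so quotient
  spaces are replaced by two maps out of the plane: \<open>E\<close> onto the torus, with the cosets
  of the sublattice as fibres, and \<open>F\<close> onto the target. The cover is \<open>F\<close>
  composed with any section of \<open>E\<close>. Rotations have to preserve the full lattice only;
  the sublattice is merely contained in it, and this makes every k available from one
  \<open>F\<close>. All branching data come from one number: if e rotations fix c modulo the full
  lattice, then e is the local degree over \<open>F c\<close> and, by orbit counting, the fibre has
  k m / e points. Elliptic functions would be the classical choice of \<open>F\<close>.
  Trigonometric functions of the lattice coordinates avoid them, because a map into three-space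
  whose image meets each ray from the origin exactly once can be normalized to a map onto the unit
  sphere with the same fibres. Coordinates are arranged so that the extra symmetry for m = 4 and m =
  6 acts as a half turn of the sphere.\<close>

lemma mset_all_eq_replicate:
  assumes "\<And>m. m \<in># P \<Longrightarrow> m = p"
  shows "P = replicate_mset (size P) p"
  using assms by (induction P) auto

text \<open>\<open>lcm\<close> expresses that no cone point lies over the branching point: every
  entry then equals the least common multiple, and an entry above 1 makes this common value at least
  2.\<close>

lemma constant_partition:
  assumes P: "is_partition_of d P" "\<exists>m\<in>#P. m > 1"
    and lcm: "\<And>m. m \<in># P \<Longrightarrow> partition_lcm P div m = 1"
  obtains p where "P = replicate_mset (size P) p" "2 \<le> p" "1 \<le> size P" "size P * p = d"
proof -
  have eq: "m = partition_lcm P" if "m \<in># P" for m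
  proof -
    have "m dvd partition_lcm P"
      using that by (auto simp: partition_lcm_def)
    then show ?thesis
      using lcm[OF that] by (metis dvd_div_mult_self mult_1)
  qed
  obtain m where m: "m \<in># P" "m > 1"
    using P(2) by blast
  have rep: "P = replicate_mset (size P) (partition_lcm P)"
    by (rule mset_all_eq_replicate) (rule eq)
  have "sum_mset P = size P * partition_lcm P"
    by (subst rep) simp
  then have "size P * partition_lcm P = d"
    using P(1) by (simp add: is_partition_of_def)
  moreover have "1 \<le> size P"
    using m by (metis One_nat_def Suc_leI nonempty_has_size not_less_eq empty_iff set_mset_empty)
  ultimately show ?thesis
    using that rep eq[OF m(1)] m(2) by auto
qed

text \<open>With s_i = d / q_i this is 1/q1 + 1/q2 + 1/q3 = 1 cleared of denominators. The largest
  summand is at least a third of the sum, which bounds q1 by 3; if q1 = 2, the larger of the other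
  two is at least d / 4, which bounds q2 by 4.\<close>

lemma three_orders:
  fixes s1 s2 s3 q1 q2 q3 d :: nat
  assumes d: "s1 * q1 = d" "s2 * q2 = d" "s3 * q3 = d" "1 \<le> d"
    and sum: "s1 + s2 + s3 = d" and ord: "q1 \<le> q2" "q2 \<le> q3" and ge: "2 \<le> q1"
  shows "(q1 = 3 \<and> q2 = 3 \<and> q3 = 3) \<or> (q1 = 2 \<and> q2 = 4 \<and> q3 = 4) \<or>
         (q1 = 2 \<and> q2 = 3 \<and> q3 = 6)"
proof -
  have pos: "0 < s1" "0 < s2" "0 < s3"
    using d by (auto intro: Nat.gr0I)
  have "s2 \<le> s1"
  proof (rule ccontr)
    assume "\<not> s2 \<le> s1"
    then have "s1 * q1 < s2 * q2"
      using ord ge by (intro mult_less_le_imp_less) auto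
    then show False using d by simp
  qed
  moreover have "s3 \<le> s2"
  proof (rule ccontr)
    assume "\<not> s3 \<le> s2"
    then have "s2 * q2 < s3 * q3"
      using ord ge by (intro mult_less_le_imp_less) auto
    then show False using d by simp
  qed
  ultimately have le: "s2 \<le> s1" "s3 \<le> s2" by auto
  have "s1 * q1 \<le> s1 * 3"
    using le d sum by linarith
  then have "q1 \<le> 3"
    using pos by simp
  then consider "q1 = 2" | "q1 = 3"
    using ge by linarith
  then show ?thesis
  proof cases
    case 1
    then have "s1 * 2 = d"
      using d by simp
    then have "s2 * q2 \<le> s2 * 4"
      using le d sum by linarith
    then have "q2 \<le> 4"
      using pos by simp
    then consider "q2 = 2" | "q2 = 3" | "q2 = 4"
      using ge ord by linarith
    then show ?thesis
    proof cases
      case 1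
      then have "s2 * 2 = d"
        using d by simp
      with \<open>s1 * 2 = d\<close> sum pos show ?thesis by linarith
    next
      case 2
      then have "s2 * 3 = d"
        using d by simp
      with \<open>s1 * 2 = d\<close> d sum have "s3 * q3 = s3 * 6" by linarith
      with pos 2 1 show ?thesis by simp
    next
      case 3
      then have "s2 * 4 = d"
        using d by simp
      with \<open>s1 * 2 = d\<close> d sum have "s3 * q3 = s3 * 4" by linarith
      with pos 3 1 show ?thesis by simp
    qed
  next
    case 2
    then have "s1 * 3 = d"
      using d by simp
    then have "s2 = s1" "s3 = s1"
      using le sum by linarith+
    then show ?thesis
      using d 2 pos by (metis mult_cancel1 not_less0)
  qed
qed

lemma obtain_sorted_list:
  fixes M :: "'a multiset" and f :: "'a \<Rightarrow> nat"
  obtains xs where "mset xs = M" "sorted (map f xs)"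
proof -
  obtain ys where "mset ys = M"
    using ex_mset by blast
  then show ?thesis
    using that[of "sort_key f ys"] by simp
qed

lemma torus_cover_classification:
  assumes c: "candidate_branched_cover c"
    and torus: "induced_source_orbifold c = torus_orbifold"
  shows "c \<in> torus_covers"
proof -
  define d where "d = cover_degree c"
  define g where "g = target_genus c"
  define M where "M = partitions c"
  have d1: "1 \<le> d" and part: "\<And>P. P \<in># M \<Longrightarrow> is_partition_of d P"
    "\<And>P. P \<in># M \<Longrightarrow> \<exists>m\<in>#P. m > 1"
    using c by (auto simp: candidate_branched_cover_def d_def M_def)
  have s1: "source_genus c = 1"
    and lcm: "\<And>P m. P \<in># M \<Longrightarrow> m \<in># P \<Longrightarrow> partition_lcm P div m = 1"
    using torus
    by (fastforce simp: induced_source_orbifold_def torus_orbifold_def M_def)+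
  have "\<exists>p. P = replicate_mset (size P) p \<and> 2 \<le> p \<and> 1 \<le> size P \<and> size P * p = d"
    if "P \<in># M" for P
    using constant_partition[OF part(1) part(2) lcm] that by metis
  then obtain p where p: "\<And>P. P \<in># M \<Longrightarrow>
      P = replicate_mset (size P) (p P) \<and> 2 \<le> p P \<and> 1 \<le> size P \<and> size P * p P = d"
    by metis
  obtain xs where xs: "mset xs = M" "sorted (map p xs)"
    by (rule obtain_sorted_list)
  have RH: "- (\<Sum>P\<leftarrow>xs. int (size P)) = int d * (2 - 2 * int g - int (length xs))"
    using c s1 sum_mset_sum_list[of "map (\<lambda>P. int (size P)) xs"]
    by (simp add: candidate_branched_cover_def euler_char_def d_def g_def flip: M_def xs(1))
  have half: "2 * int (size P) \<le> int d \<and> 1 \<le> size P" if "P \<in> set xs" for P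
  proof -
    have "P \<in># M" using that xs by auto
    with p[of P] have "size P * 2 \<le> size P * p P" "1 \<le> size P" "size P * p P = d"
      by auto
    then show ?thesis by simp
  qed
  \<comment> \<open>As the n lengths are at most d / 2 each, Riemann-Hurwitz gives n \<le> 4 - 4 g:
    either the torus without branching or the sphere with at most four branching points.\<close>
  have "2 * (\<Sum>P\<leftarrow>ys. int (size P)) \<le> int d * int (length ys)" if "set ys \<subseteq> set xs" for ys
    using that half by (induction ys) (force simp: algebra_simps)+
  from this[of xs] have "int d * (2 * (2 - 2 * int g - int (length xs)) + int (length xs)) \<ge> 0"
    using RH by (simp add: algebra_simps)
  then have n: "int (length xs) \<le> 4 - 4 * int g"
    using d1 by (simp add: zero_le_mult_iff)
  have ceq: "c = \<lparr>source_genus = 1, target_genus = g, cover_degree = d, partitions = M\<rparr>"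
    using s1 by (simp add: d_def g_def M_def)
  have mem: "P \<in># M" if "P \<in> set xs" for P
    using that xs by auto
  consider "g = 1" "length xs = 0" | "g = 0" "length xs \<le> 4"
    using n by linarith
  then show ?thesis
  proof cases
    case 1
    then show ?thesis
      using xs d1 unfolding ceq torus_covers_def by auto
  next
    case 2
    then consider "xs = []" | P1 where "xs = [P1]" | P1 P2 where "xs = [P1, P2]"
      | P1 P2 P3 where "xs = [P1, P2, P3]" | P1 P2 P3 P4 where "xs = [P1, P2, P3, P4]"
      by (auto simp: le_Suc_eq numeral_eq_Suc length_Suc_conv)
    then show ?thesis
    proof cases
      \<comment> \<open>On the sphere the lengths add up to (n - 2) d, which excludes n \<le>
        2.\<close>
      case 1
      then show ?thesis using RH 2 d1 by simp
    next
      case (2 P1)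
      then show ?thesis using RH \<open>g = 0\<close> d1 by simp
    next
      case (3 P1 P2)
      then show ?thesis using RH \<open>g = 0\<close> half by force
    next
      case (4 P1 P2 P3)
      note x = 4
      have M: "M = {#P1, P2, P3#}"
        using xs x by simp
      have sum: "size P1 + size P2 + size P3 = d"
        using RH x \<open>g = 0\<close> by simp
      have P: "P1 = replicate_mset (size P1) (p P1)" "P2 = replicate_mset (size P2) (p P2)"
        "P3 = replicate_mset (size P3) (p P3)" "size P1 * p P1 = d" "size P2 * p P2 = d"
        "size P3 * p P3 = d" "2 \<le> p P1"
        using p[OF mem] x by auto
      have ord: "p P1 \<le> p P2" "p P2 \<le> p P3"
        using xs x by auto
      consider "p P1 = 3" "p P2 = 3" "p P3 = 3" | "p P1 = 2" "p P2 = 4" "p P3 = 4"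
        | "p P1 = 2" "p P2 = 3" "p P3 = 6"
        using three_orders[OF P(4-6) d1 sum ord P(7)] by blast
      then show ?thesis
      proof cases
        case 1
        define k where "k = size P1"
        have "size P1 = k" "size P2 = k" "size P3 = k" "d = 3 * k" "1 \<le> k"
          using 1 P(4-6) d1 by (auto simp: k_def)
        then have "M = {#replicate_mset k 3, replicate_mset k 3, replicate_mset k 3#}"
          using M P 1 by metis
        then show ?thesis
          using \<open>d = 3 * k\<close> \<open>1 \<le> k\<close> \<open>g = 0\<close> unfolding ceq torus_covers_def by auto
      next
        case 2
        define k where "k = size P2"
        have "size P1 = 2 * k" "size P2 = k" "size P3 = k" "d = 4 * k" "1 \<le> k"
          using 2 P(4-6) d1 by (auto simp: k_def)
        then have "M = {#replicate_mset (2 * k) 2, replicate_mset k 4, replicate_mset k 4#}"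
          using M P 2 by metis
        then show ?thesis
          using \<open>d = 4 * k\<close> \<open>1 \<le> k\<close> \<open>g = 0\<close> unfolding ceq torus_covers_def by auto
      next
        case 3
        define k where "k = size P3"
        have "size P1 = 3 * k" "size P2 = 2 * k" "size P3 = k" "d = 6 * k" "1 \<le> k"
          using 3 P(4-6) d1 by (auto simp: k_def)
        then have "M = {#replicate_mset (3 * k) 2, replicate_mset (2 * k) 3, replicate_mset k 6#}"
          using M P 3 by metis
        then show ?thesis
          using \<open>d = 6 * k\<close> \<open>1 \<le> k\<close> \<open>g = 0\<close> unfolding ceq torus_covers_def by auto
      qed
    next
      case (5 P1 P2 P3 P4)
      note x = 5
      define k where "k = size P1"
      have M: "M = {#P1, P2, P3, P4#}"
        using xs x by simp
      \<comment> \<open>Four lengths of at most d / 2 with sum 2 d are all equal to d / 2, so every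
        order is 2.\<close>
      have "size P1 + size P2 + size P3 + size P4 = 2 * d"
        using RH x \<open>g = 0\<close> by simp
      moreover have "2 * size P1 \<le> d" "2 * size P2 \<le> d" "2 * size P3 \<le> d" "2 * size P4 \<le> d"
        using half[of P1] half[of P2] half[of P3] half[of P4] x by auto
      ultimately have s: "size P1 = k" "size P2 = k" "size P3 = k" "size P4 = k" "d = 2 * k"
        unfolding k_def by linarith+
      have k1: "1 \<le> k" using s d1 by simp
      have "P = replicate_mset k 2" if "P \<in> {P1, P2, P3, P4}" for P
        using p[OF mem, of P] that x s k1 by auto
      then have "M = {#replicate_mset k 2, replicate_mset k 2, replicate_mset k 2, replicate_mset k 2#}"
        using M by blast
      then show ?thesis
        using s k1 \<open>g = 0\<close> unfolding ceq torus_covers_def by auto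
    qed
  qed
qed

lemma torus_covers_candidates:
  assumes "c \<in> torus_covers"
  shows "candidate_branched_cover c" "induced_source_orbifold c = torus_orbifold"
proof -
  obtain k where k: "1 \<le> k" and c: "c \<in> 
    {\<lparr>source_genus = 1, target_genus = 1, cover_degree = k, partitions = {#}\<rparr>,
     \<lparr>source_genus = 1, target_genus = 0, cover_degree = 2 * k, partitions =
       {#replicate_mset k 2, replicate_mset k 2, replicate_mset k 2, replicate_mset k 2#}\<rparr>,
     \<lparr>source_genus = 1, target_genus = 0, cover_degree = 3 * k, partitions =
       {#replicate_mset k 3, replicate_mset k 3, replicate_mset k 3#}\<rparr>,
     \<lparr>source_genus = 1, target_genus = 0, cover_degree = 4 * k, partitions =
       {#replicate_mset (2 * k) 2, replicate_mset k 4, replicate_mset k 4#}\<rparr>,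
     \<lparr>source_genus = 1, target_genus = 0, cover_degree = 6 * k, partitions =
       {#replicate_mset (3 * k) 2, replicate_mset (2 * k) 3, replicate_mset k 6#}\<rparr>}"
    using assms unfolding torus_covers_def by auto
  have lcm: "partition_lcm (replicate_mset j m) = m" if "0 < j" for j m
    using that by (simp add: partition_lcm_def)
  show "candidate_branched_cover c"
    using c k by (auto simp: candidate_branched_cover_def is_partition_of_def euler_char_def)
  show "induced_source_orbifold c = torus_orbifold"
    using c k by (auto simp: induced_source_orbifold_def torus_orbifold_def lcm)
qed

section \<open>Local model of a quotient map\<close>

lemma open_image_power_shift:
  fixes U :: "complex set"
  assumes "open U" "1 \<le> e"
  shows "open ((\<lambda>u. (u - c) ^ e) ` U)"
proof (rule open_mapping_thm[where S = UNIV])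
  show "\<not> (\<lambda>u. (u - c) ^ e) constant_on UNIV"
  proof
    assume "(\<lambda>u. (u - c) ^ e) constant_on UNIV"
    then obtain y where "\<And>u. (u - c) ^ e = y"
      by (auto simp: constant_on_def)
    from this[of c] this[of "c + 1"] show False
      using assms by (simp add: power_0_left)
  qed
qed (use assms in \<open>auto intro!: holomorphic_intros\<close>)

lemma power_shift_image_ball:
  fixes c :: complex
  assumes "0 < r" "1 \<le> e"
  shows "(\<lambda>u. (u - c) ^ e) ` ball c r = ball 0 (r ^ e)"
proof (intro equalityI subsetI)
  fix w assume "w \<in> (\<lambda>u. (u - c) ^ e) ` ball c r"
  then obtain u where u: "cmod (u - c) < r" "w = (u - c) ^ e"
    by (metis (no_types, lifting) dist_norm imageE mem_ball norm_minus_commute)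
  then have "cmod (u - c) ^ e < r ^ e"
    using assms by (intro power_strict_mono) auto
  then show "w \<in> ball 0 (r ^ e)"
    using u by (simp add: norm_power)
next
  fix w :: complex assume w: "w \<in> ball 0 (r ^ e)"
  obtain v where v: "v ^ e = w"
    using assms exists_complex_root[of e w] by auto
  then have "cmod v ^ e < r ^ e"
    using w by (auto simp: norm_power)
  then have "cmod v < r"
    using assms by (meson less_eq_real_def power_less_imp_less_base)
  then have "v + c \<in> ball c r" "w = (v + c - c) ^ e"
    using v by (auto simp: dist_norm)
  then show "w \<in> (\<lambda>u. (u - c) ^ e) ` ball c r"
    by blast
qed

text \<open>The quotient of a disc by a rotation group of order \<open>e\<close> is a disc, with quotient map
  \<open>z \<mapsto> z ^ e\<close>; so an open map with the right fibres has the right local model without any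
  explicit chart in the target.\<close>

lemma power_model_at_quotient:
  fixes E :: "complex \<Rightarrow> 'a::topological_space" and F :: "complex \<Rightarrow> 'b::topological_space"
  assumes r: "0 < r" and e: "1 \<le> e"
    and contE: "continuous_on UNIV E" and openE: "\<And>U. open U \<Longrightarrow> openin (top_of_set S) (E ` U)"
    and contF: "continuous_on UNIV F" and openF: "\<And>U. open U \<Longrightarrow> openin (top_of_set T) (F ` U)"
    and inj: "inj_on E (ball c r)"
    and fib: "\<And>u v. u \<in> ball c r \<Longrightarrow> v \<in> ball c r \<Longrightarrow> F u = F v \<longleftrightarrow> (u - c) ^ e = (v - c) ^ e"
    and f: "\<And>z. f (E z) = F z"
  shows "power_model_at S T f (E c) e"
proof -
  define D where "D = ball c r"
  have D: "open D" "c \<in> D"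
    using r by (auto simp: D_def)
  have sub: "openin (top_of_set (G ` D)) (G ` W)"
    if "\<And>U. open U \<Longrightarrow> openin (top_of_set X) (G ` U)" "open W" "W \<subseteq> D"
    for X W and G :: "complex \<Rightarrow> 'z::topological_space"
  proof (rule openin_subset_trans[of X])
    show "G ` D \<subseteq> X"
      using that(1)[OF D(1)] openin_imp_subset by blast
  qed (use that in auto)
  obtain E' where E': "homeomorphism D (E ` D) E E'"
  proof (rule homeomorphism_injective_open_map)
    show "continuous_on D E"
      using contE continuous_on_subset by blast
    show "openin (top_of_set (E ` D)) (E ` U)" if "openin (top_of_set D) U" for U
      using that D by (intro sub[OF openE]) (auto simp: openin_open_eq)
  qed (use inj in \<open>auto simp: D_def\<close>)
  have shift: "homeomorphism D (ball 0 r) (\<lambda>z. z - c) (\<lambda>z. z + c)"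
    by (rule homeomorphismI) (auto simp: D_def dist_norm norm_minus_commute intro!: continuous_intros)
  define \<phi> where "\<phi> = (\<lambda>z. z - c) \<circ> E'"
  have hom\<phi>: "homeomorphism (E ` D) (ball 0 r) \<phi> (E \<circ> (\<lambda>z. z + c))"
    unfolding \<phi>_def using E' shift homeomorphism_compose homeomorphism_symD by blast
  have \<phi>E: "\<phi> (E z) = z - c" if "z \<in> D" for z
    using that E' by (simp add: \<phi>_def homeomorphism_apply1)
  \<comment> \<open>By \<open>fib\<close> the arbitrary choice made by \<open>inv_into\<close> does
    not affect the power. This chart is continuous because F is open, and open because F is
    continuous and the power map is open.\<close>
  define \<psi> where "\<psi> y = (inv_into D F y - c) ^ e" for y
  have \<psi>F: "\<psi> (F z) = (z - c) ^ e" if "z \<in> D" for z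
  proof -
    have "inv_into D F (F z) \<in> D" "F (inv_into D F (F z)) = F z"
      using that by (auto simp: inv_into_into f_inv_into_f)
    then show ?thesis
      using that fib by (simp add: \<psi>_def D_def)
  qed
  have \<psi>image: "\<psi> ` F ` W = (\<lambda>z. (z - c) ^ e) ` W" if "W \<subseteq> D" for W
    using that \<psi>F by (force simp: image_image)
  obtain \<psi>' where hom\<psi>: "homeomorphism (F ` D) (ball 0 (r ^ e)) \<psi> \<psi>'"
  proof (rule homeomorphism_injective_open_map)
    show "\<psi> ` F ` D = ball 0 (r ^ e)"
      using \<psi>image[of D] power_shift_image_ball[OF r e] by (simp add: D_def)
    show "inj_on \<psi> (F ` D)"
      using \<psi>F fib by (auto simp: inj_on_def D_def)
    have "openin (top_of_set (F ` D)) (F ` D \<inter> \<psi> -` B)" if "open B" for B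
    proof -
      have "F ` D \<inter> \<psi> -` B = F ` (D \<inter> (\<lambda>z. (z - c) ^ e) -` B)"
        using \<psi>F by auto
      moreover have "open (D \<inter> (\<lambda>z. (z - c) ^ e) -` B)"
        using that D by (intro open_Int open_vimage) (auto intro!: continuous_intros)
      ultimately show ?thesis
        using sub[OF openF] by auto
    qed
    then show "continuous_on (F ` D) \<psi>"
      unfolding continuous_on_open_invariant
      by (metis (no_types, lifting) Int_commute openin_open)
    show "openin (top_of_set (ball 0 (r ^ e))) (\<psi> ` U)" if U: "openin (top_of_set (F ` D)) U" for U
    proof -
      have "openin (top_of_set D) (D \<inter> F -` U)"
        using contF U by (meson continuous_on_open continuous_on_subset subset_UNIV)
      then have "open (D \<inter> F -` U)"
        using D openin_open_eq by blast
      moreover have "U = F ` (D \<inter> F -` U)"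
        using openin_imp_subset[OF U] by auto
      moreover have "\<psi> ` F ` (D \<inter> F -` U) = (\<lambda>z. (z - c) ^ e) ` (D \<inter> F -` U)"
        by (rule \<psi>image) auto
      ultimately have "open (\<psi> ` U)"
        using open_image_power_shift[OF _ e] by metis
      moreover have "\<psi> ` U \<subseteq> ball 0 (r ^ e)"
        using openin_imp_subset[OF U] \<psi>image[of D] power_shift_image_ball[OF r e]
        unfolding D_def by (metis image_mono order_refl)
      ultimately show ?thesis
        by (simp add: openin_open_eq)
    qed
  qed
  show ?thesis
    unfolding power_model_at_def
  proof (intro conjI e exI)
    show "homeomorphism (E ` D) (ball 0 r) \<phi> (E \<circ> (\<lambda>z. z + c))" "homeomorphism (F ` D) (ball 0 (r ^ e)) \<psi> \<psi>'"
      by (fact hom\<phi> hom\<psi>)+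
    show "f ` E ` D \<subseteq> F ` D"
      using f by auto
  qed (use D openE openF \<phi>E \<psi>F e f in auto)
qed

section \<open>Lattices and orbit maps\<close>

declare One_nat_def [simp del]

text \<open>Only the generator 1 is stretched: for non-real \<tau> and positive k this has index k
  in \<open>torus_lattice 1 \<tau>\<close>.\<close>

definition torus_lattice :: "nat \<Rightarrow> complex \<Rightarrow> complex set" where
  "torus_lattice k \<tau> = {of_int i * of_nat k + of_int j * \<tau> |i j. True}"

lemma torus_latticeI: "z = of_int i * of_nat k + of_int j * \<tau> \<Longrightarrow> z \<in> torus_lattice k \<tau>"
  unfolding torus_lattice_def by blast

lemma torus_lattice_0 [simp]: "0 \<in> torus_lattice k \<tau>"
  by (rule torus_latticeI[of _ 0 _ 0]) simp

lemma torus_lattice_add: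
  assumes "z \<in> torus_lattice k \<tau>" "w \<in> torus_lattice k \<tau>"
  shows "z + w \<in> torus_lattice k \<tau>"
proof -
  obtain i j i' j' where "z = of_int i * of_nat k + of_int j * \<tau>" "w = of_int i' * of_nat k + of_int j' * \<tau>"
    using assms unfolding torus_lattice_def by blast
  then show ?thesis
    by (intro torus_latticeI[of _ "i + i'" _ "j + j'"]) (simp add: algebra_simps)
qed

lemma torus_lattice_minus:
  assumes "z \<in> torus_lattice k \<tau>"
  shows "- z \<in> torus_lattice k \<tau>"
proof -
  obtain i j where "z = of_int i * of_nat k + of_int j * \<tau>"
    using assms unfolding torus_lattice_def by blast
  then show ?thesis
    by (intro torus_latticeI[of _ "- i" _ "- j"]) (simp add: algebra_simps)
qed

lemma torus_lattice_minus_iff [simp]: "- z \<in> torus_lattice k \<tau> \<longleftrightarrow> z \<in> torus_lattice k \<tau>"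
  using torus_lattice_minus by fastforce

lemma torus_lattice_diff:
  "z \<in> torus_lattice k \<tau> \<Longrightarrow> w \<in> torus_lattice k \<tau> \<Longrightarrow> z - w \<in> torus_lattice k \<tau>"
  using torus_lattice_add[of z k \<tau> "- w"] by simp

lemma torus_lattice_subset: "torus_lattice k \<tau> \<subseteq> torus_lattice 1 \<tau>"
proof
  fix z assume "z \<in> torus_lattice k \<tau>"
  then obtain i j where "z = of_int i * of_nat k + of_int j * \<tau>"
    unfolding torus_lattice_def by blast
  then show "z \<in> torus_lattice 1 \<tau>"
    by (intro torus_latticeI[of _ "i * int k" _ j]) simp
qed

text \<open>\<open>coord1\<close> and \<open>coord2\<close> are the real coordinates of z in the
  basis 1, \<tau>.\<close>

definition coord1 :: "complex \<Rightarrow> complex \<Rightarrow> real" where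
  "coord1 \<tau> z = Re z - Im z / Im \<tau> * Re \<tau>"

definition coord2 :: "complex \<Rightarrow> complex \<Rightarrow> real" where
  "coord2 \<tau> z = Im z / Im \<tau>"

lemma coords_add [simp]:
  "coord1 \<tau> (z + w) = coord1 \<tau> z + coord1 \<tau> w" "coord2 \<tau> (z + w) = coord2 \<tau> z + coord2 \<tau> w"
  "coord1 \<tau> (z - w) = coord1 \<tau> z - coord1 \<tau> w" "coord2 \<tau> (z - w) = coord2 \<tau> z - coord2 \<tau> w"
  by (simp_all add: coord1_def coord2_def add_divide_distrib diff_divide_distrib algebra_simps)

lemma coords_expand:
  "Im \<tau> \<noteq> 0 \<Longrightarrow> z = of_real (coord1 \<tau> z) + of_real (coord2 \<tau> z) * \<tau>"
  by (simp add: complex_eq_iff coord1_def coord2_def)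

lemma coords_of_real [simp]:
  assumes "Im \<tau> \<noteq> 0"
  shows "coord1 \<tau> (of_real x + of_real y * \<tau>) = x" "coord2 \<tau> (of_real x + of_real y * \<tau>) = y"
  using assms by (simp_all add: coord1_def coord2_def)

lemma torus_lattice_iff_coords:
  assumes "Im \<tau> \<noteq> 0" "1 \<le> k"
  shows "z \<in> torus_lattice k \<tau> \<longleftrightarrow> coord1 \<tau> z / k \<in> \<int> \<and> coord2 \<tau> z \<in> \<int>"
proof
  assume "z \<in> torus_lattice k \<tau>"
  then obtain i j where "z = of_int i * of_nat k + of_int j * \<tau>"
    unfolding torus_lattice_def by blast
  then have "z = of_real (of_int i * of_nat k) + of_real (of_int j) * \<tau>"
    by simp
  then have "coord1 \<tau> z = of_int i * of_nat k" "coord2 \<tau> z = of_int j"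
    using coords_of_real[OF assms(1)] by metis+
  then show "coord1 \<tau> z / k \<in> \<int> \<and> coord2 \<tau> z \<in> \<int>"
    using assms by simp
next
  assume "coord1 \<tau> z / k \<in> \<int> \<and> coord2 \<tau> z \<in> \<int>"
  then obtain i j where "coord1 \<tau> z / k = of_int i" "coord2 \<tau> z = of_int j"
    by (auto elim!: Ints_cases)
  then have "coord1 \<tau> z = of_int i * k" "coord2 \<tau> z = of_int j"
    using assms by (auto simp: field_simps)
  then show "z \<in> torus_lattice k \<tau>"
    using coords_expand[OF assms(1), of z] by (intro torus_latticeI[of _ i _ j]) simp
qed

text \<open>Separates the translates by 0, ..., k - 1 when the points of a fibre are
  counted.\<close>

lemma of_int_in_torus_lattice:
  assumes "Im \<tau> \<noteq> 0" "1 \<le> k" "of_int a \<in> torus_lattice k \<tau>"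
  shows "int k dvd a"
proof -
  have "real_of_int a / k \<in> \<int>"
    using assms torus_lattice_iff_coords[of \<tau> k "of_int a"] by (simp add: coord1_def)
  then obtain i where "real_of_int a / k = of_int i"
    by (auto elim: Ints_cases)
  then have "real_of_int a = of_int (i * int k)"
    using assms(2) by (simp add: field_simps)
  then show ?thesis
    by (simp only: of_int_eq_iff dvd_triv_right)
qed

lemma continuous_on_coords [continuous_intros]:
  "continuous_on A f \<Longrightarrow> continuous_on A (\<lambda>x. coord1 \<tau> (f x))"
  "continuous_on A f \<Longrightarrow> continuous_on A (\<lambda>x. coord2 \<tau> (f x))"
proof -
  have "coord1 \<tau> z = Re z - Im z * (Re \<tau> / Im \<tau>)" "coord2 \<tau> z = Im z * (1 / Im \<tau>)" for z
    by (simp_all add: coord1_def coord2_def)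
  then show "continuous_on A f \<Longrightarrow> continuous_on A (\<lambda>x. coord1 \<tau> (f x))"
    "continuous_on A f \<Longrightarrow> continuous_on A (\<lambda>x. coord2 \<tau> (f x))"
    by (simp_all only:) (intro continuous_intros; assumption)+
qed

lemma compact_fundamental_domain:
  assumes "Im \<tau> \<noteq> 0" "1 \<le> k"
  obtains K where "compact K" "\<And>z. \<exists>l\<in>torus_lattice k \<tau>. z + l \<in> K"
proof
  define g where "g = (\<lambda>(x, y). of_real x + of_real y * \<tau>)"
  show "compact (g ` ({0..real k} \<times> {0..1}))"
    unfolding g_def case_prod_unfold
    by (intro compact_continuous_image continuous_intros compact_Times compact_Icc)
  fix z
  define i j where "i = \<lfloor>coord1 \<tau> z / k\<rfloor>" and "j = \<lfloor>coord2 \<tau> z\<rfloor>"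
  define l where "l = of_int (- i) * of_nat k + of_int (- j) * \<tau>"
  have "l \<in> torus_lattice k \<tau>"
    unfolding l_def by (rule torus_latticeI) (rule refl)
  moreover have "z + l = g (coord1 \<tau> z - i * k, coord2 \<tau> z - j)"
    by (subst coords_expand[OF assms(1), of z]) (simp add: g_def l_def algebra_simps)
  moreover have "coord1 \<tau> z - i * k \<in> {0..real k}"
  proof -
    have "i \<le> coord1 \<tau> z / k" "coord1 \<tau> z / k \<le> i + 1"
      unfolding i_def by linarith+
    then show ?thesis
      using assms by (auto simp: field_simps)
  qed
  moreover have "coord2 \<tau> z - j \<in> {0..1}"
    unfolding j_def by auto linarith
  ultimately show "\<exists>l\<in>torus_lattice k \<tau>. z + l \<in> g ` ({0..real k} \<times> {0..1})"
    by (metis (no_types, lifting) image_eqI mem_Sigma_iff)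
qed

lemma torus_lattice_discrete:
  assumes "Im \<tau> \<noteq> 0" "1 \<le> k"
  obtains \<delta> where "0 < \<delta>" "\<And>l. l \<in> torus_lattice k \<tau> \<Longrightarrow> cmod l < \<delta> \<Longrightarrow> l = 0"
proof
  \<comment> \<open>An imaginary part below that of \<tau> forces j = 0, and then a modulus below 1
    forces i = 0.\<close>
  show "0 < min 1 \<bar>Im \<tau>\<bar>"
    using assms by simp
  fix l assume l: "l \<in> torus_lattice k \<tau>" "cmod l < min 1 \<bar>Im \<tau>\<bar>"
  then obtain i j where ij: "l = of_int i * of_nat k + of_int j * \<tau>"
    unfolding torus_lattice_def by blast
  have "real_of_int \<bar>j\<bar> * \<bar>Im \<tau>\<bar> < 1 * \<bar>Im \<tau>\<bar>"
    using abs_Im_le_cmod[of l] l(2) by (simp add: ij abs_mult)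
  then have "real_of_int \<bar>j\<bar> < 1"
    using assms by (subst (asm) mult_less_cancel_right) auto
  then have j: "j = 0"
    by linarith
  have "cmod l = real_of_int \<bar>i\<bar> * real k"
    by (simp add: ij j norm_mult)
  then have "real_of_int \<bar>i\<bar> * real k < 1 * real k"
    using l(2) assms(2) by (metis less_le_trans min_less_iff_conj mult_1 of_nat_1 of_nat_le_iff)
  then have "real_of_int \<bar>i\<bar> < 1"
    using assms by (subst (asm) mult_less_cancel_right) auto
  then have "i = 0"
    by linarith
  then show "l = 0"
    by (simp add: ij j)
qed

lemma translated_lattice_isolated:
  assumes "Im \<tau> \<noteq> 0" "1 \<le> k"
  obtains r where "0 < r" "\<And>l. l \<in> torus_lattice k \<tau> \<Longrightarrow> cmod (p + l) < r \<Longrightarrow> p + l = 0"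
proof -
  obtain \<delta> where \<delta>: "0 < \<delta>" "\<And>l. l \<in> torus_lattice k \<tau> \<Longrightarrow> cmod l < \<delta> \<Longrightarrow> l = 0"
    using torus_lattice_discrete[OF assms] by blast
  show ?thesis
  proof (cases "\<exists>l\<in>torus_lattice k \<tau>. cmod (p + l) < \<delta> / 2 \<and> p + l \<noteq> 0")
    case False
    then show ?thesis
      using \<delta>(1) by (intro that[of "\<delta> / 2"]) auto
  next
    case True
    then obtain l where l: "l \<in> torus_lattice k \<tau>" "cmod (p + l) < \<delta> / 2" "p + l \<noteq> 0"
      by blast
    \<comment> \<open>Two translates within \<delta> / 2 of the origin differ by a lattice vector
      shorter than \<delta>, so p + l is the only one; its own modulus is a radius that excludes
      it.\<close>
    show ?thesis
    proof (rule that[of "cmod (p + l)"])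
      show "0 < cmod (p + l)"
        using l by simp
      fix l' assume l': "l' \<in> torus_lattice k \<tau>" "cmod (p + l') < cmod (p + l)"
      have "cmod (l' - l) = cmod ((p + l') - (p + l))"
        by simp
      also have "\<dots> \<le> cmod (p + l') + cmod (p + l)"
        by (rule norm_triangle_ineq4)
      also have "\<dots> < \<delta>"
        using l' l by linarith
      finally have "l' - l = 0"
        using \<delta>(2) torus_lattice_diff l' l by blast
      then show "p + l' = 0"
        using l' by simp
    qed
  qed
qed

text \<open>Multiplication by x permutes G, so comparing the products over G gives
  \<open>x ^ card G = 1\<close>. There are exactly \<open>card G\<close> such roots, so the
  inclusion is an equality.\<close>

lemma closed_under_mult_eq_roots:
  fixes G :: "complex set"
  assumes G: "finite G" "G \<noteq> {}" "0 \<notin> G" "\<And>x y. x \<in> G \<Longrightarrow> y \<in> G \<Longrightarrow> x * y \<in> G"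
  shows "G = {x. x ^ card G = 1}"
proof -
  have "x ^ card G = 1" if x: "x \<in> G" for x
  proof -
    have inj: "inj_on ((*) x) G"
      using x G by (auto simp: inj_on_def)
    have "(*) x ` G = G"
      using G x by (intro card_subset_eq) (auto simp: card_image[OF inj])
    then have "\<Prod>G = (\<Prod>y\<in>G. x * y)"
      using inj by (metis (mono_tags, lifting) prod.reindex_cong)
    then have "\<Prod>G = x ^ card G * \<Prod>G"
      by (simp add: prod.distrib)
    moreover have "\<Prod>G \<noteq> 0"
      using G by simp
    ultimately show ?thesis
      by simp
  qed
  moreover have c: "card G \<noteq> 0"
    using G by simp
  moreover have "card {x::complex. x ^ card G = 1} = card G" "finite {x::complex. x ^ card G = 1}"
    using c by (auto simp: card_roots_unity_eq finite_roots_unity)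
  ultimately show ?thesis
    by (intro card_subset_eq) auto
qed

text \<open>Both maps out of the plane are instances: the torus with m = 1 and the sublattice, the
  orbifold quotient with k = 1. Openness is derived in \<open>open_map\<close>.\<close>

locale orbit_map =
  fixes k :: nat and \<tau> :: complex and m :: nat and F :: "complex \<Rightarrow> 'a::t2_space" and T :: "'a set"
  assumes \<tau>: "Im \<tau> \<noteq> 0" and k: "1 \<le> k" and m: "1 \<le> m"
    and cont: "continuous_on UNIV F" and onto: "range F = T"
    and fib: "\<And>z w. F z = F w \<longleftrightarrow> (\<exists>\<zeta> l. \<zeta> ^ m = 1 \<and> l \<in> torus_lattice k \<tau> \<and> w = \<zeta> * z + l)"
begin

lemma periodic: "l \<in> torus_lattice k \<tau> \<Longrightarrow> F (z + l) = F z"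
  using fib[of z "z + l"] by (metis mult_1 power_one)

text \<open>The saturation of U is a union of affine preimages of U, hence open. Removing it from a
  compact set that meets every orbit leaves a compact set; its image is closed, as the codomain is
  Hausdorff, and is the complement of the image of U in T.\<close>

lemma open_map:
  assumes "open U"
  shows "openin (top_of_set T) (F ` U)"
proof -
  have "F -` F ` U = (\<Union>\<zeta>\<in>{\<zeta>. \<zeta> ^ m = 1}. \<Union>l\<in>torus_lattice k \<tau>. (\<lambda>w. \<zeta> * w + l) -` U)"
    (is "_ = ?R")
    unfolding vimage_def image_def by (simp add: fib) blast
  moreover have "open ((\<lambda>w. \<zeta> * w + l) -` U)" for \<zeta> l
    by (rule open_vimage[OF assms]) (intro continuous_intros)
  then have "open ?R"
    by (intro open_UN ballI)
  ultimately have op: "open (F -` F ` U)"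
    by simp
  obtain K where K: "compact K" "\<And>z. \<exists>l\<in>torus_lattice k \<tau>. z + l \<in> K"
    using compact_fundamental_domain[OF \<tau> k] by blast
  have "compact (F ` (K - F -` F ` U))"
    using K op cont by (intro compact_continuous_image compact_diff) (auto intro: continuous_on_subset)
  then have "closed (F ` (K - F -` F ` U))"
    by (rule compact_imp_closed)
  moreover have "F ` U = T - F ` (K - F -` F ` U)"
  proof (intro equalityI subsetI)
    fix y assume y: "y \<in> T - F ` (K - F -` F ` U)"
    then obtain z where z: "y = F z"
      using onto by auto
    obtain l where "l \<in> torus_lattice k \<tau>" "z + l \<in> K"
      using K by blast
    then show "y \<in> F ` U"
      using y z periodic[of l z] by (metis DiffI DiffD2 image_eqI vimageE)
  next
    fix y assume "y \<in> F ` U"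
    then show "y \<in> T - F ` (K - F -` F ` U)"
      using onto by (metis DiffD2 DiffI imageE image_eqI rangeI vimageI)
  qed
  ultimately show ?thesis
    by (metis Diff_eq open_closed openin_open_Int double_complement)
qed

text \<open>For each of the finitely many rotations, the images of c other than c itself keep a
  positive distance from c. In a small disc only maps fixing c can therefore identify
  points.\<close>

lemma local_fibres:
  "\<exists>r>0. \<forall>u\<in>ball c r. \<forall>v\<in>ball c r. F u = F v \<longrightarrow>
     (\<exists>\<zeta>. \<zeta> ^ m = 1 \<and> (\<zeta> - 1) * c \<in> torus_lattice k \<tau> \<and> v - c = \<zeta> * (u - c))"
proof -
  define R where "R = {\<zeta>::complex. \<zeta> ^ m = 1}"
  have R: "finite R" "1 \<in> R"
    using finite_roots_unity[OF m] by (auto simp: R_def)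
  have "\<exists>r>0. \<forall>l\<in>torus_lattice k \<tau>. cmod ((\<zeta> * c - c) + l) < r \<longrightarrow> (\<zeta> * c - c) + l = 0" for \<zeta>
    using translated_lattice_isolated[OF \<tau> k] by metis
  then obtain \<rho> where \<rho>: "\<And>\<zeta>. 0 < \<rho> \<zeta>"
    "\<And>\<zeta> l. l \<in> torus_lattice k \<tau> \<Longrightarrow> cmod ((\<zeta> * c - c) + l) < \<rho> \<zeta> \<Longrightarrow> (\<zeta> * c - c) + l = 0"
    by metis
  \<comment> \<open>The half pays for the triangle inequality, to which u and v contribute less than
    r each.\<close>
  define r where "r = Min (\<rho> ` R) / 2"
  show ?thesis
  proof (intro exI[of _ r] conjI ballI impI)
    have "0 < Min (\<rho> ` R)"
      using R \<rho>(1) by (subst Min_gr_iff) auto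
    then show "0 < r"
      by (simp add: r_def)
    fix u v assume uv: "u \<in> ball c r" "v \<in> ball c r" "F u = F v"
    then obtain \<zeta> l where z: "\<zeta> ^ m = 1" "l \<in> torus_lattice k \<tau>" "v = \<zeta> * u + l"
      using fib by blast
    have "cmod \<zeta> = 1"
      using z(1) m by (auto dest!: power_eq_1_iff)
    have eq: "(\<zeta> * c - c) + l = (v - c) - \<zeta> * (u - c)"
      using z by (simp add: algebra_simps)
    have "cmod ((\<zeta> * c - c) + l) \<le> cmod (v - c) + cmod (\<zeta> * (u - c))"
      unfolding eq by (rule norm_triangle_ineq4)
    also have "cmod (\<zeta> * (u - c)) = cmod (u - c)"
      by (simp add: norm_mult \<open>cmod \<zeta> = 1\<close>)
    also have "cmod (v - c) + cmod (u - c) < 2 * r"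
      using uv(1,2) by (simp add: dist_norm norm_minus_commute)
    also have "2 * r = Min (\<rho> ` R)"
      by (simp add: r_def)
    also have "\<dots> \<le> \<rho> \<zeta>"
      by (rule Min_le) (use R z(1) in \<open>auto simp: R_def\<close>)
    finally have 0: "(\<zeta> * c - c) + l = 0"
      by (rule \<rho>(2)[OF z(2)])
    have "(\<zeta> - 1) * c = (\<zeta> * c - c + l) - l"
      by (simp add: left_diff_distrib)
    then have "(\<zeta> - 1) * c = - l"
      unfolding 0 by simp
    then have "(\<zeta> - 1) * c \<in> torus_lattice k \<tau>"
      using z torus_lattice_minus by simp
    moreover have "v - c = \<zeta> * (u - c)"
      using eq 0 by simp
    ultimately show "\<exists>\<zeta>. \<zeta> ^ m = 1 \<and> (\<zeta> - 1) * c \<in> torus_lattice k \<tau> \<and> v - c = \<zeta> * (u - c)"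
      using z by blast
  qed
qed

end

section \<open>Stabilizers and the induced branched cover\<close>

locale lattice_action =
  fixes \<tau> :: complex and m :: nat
  assumes \<tau>: "Im \<tau> \<noteq> 0" and m: "1 \<le> m"
    and rot: "\<And>\<zeta> l. \<zeta> ^ m = 1 \<Longrightarrow> l \<in> torus_lattice 1 \<tau> \<Longrightarrow> \<zeta> * l \<in> torus_lattice 1 \<tau>"
begin

text \<open>A root \<zeta> stands for the map
  \<open>z \<mapsto> \<zeta> * z - (\<zeta> - 1) * c\<close>, the only one with rotation part
  \<zeta> that fixes c; it belongs to the group exactly if its translation part is in the
  lattice.\<close>

definition stab :: "complex \<Rightarrow> complex set" where
  "stab c = {\<zeta>. \<zeta> ^ m = 1 \<and> (\<zeta> - 1) * c \<in> torus_lattice 1 \<tau>}"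

lemma root_nonzero: "\<zeta> ^ m = 1 \<Longrightarrow> (\<zeta>::complex) \<noteq> 0"
  using m by (auto simp: power_0_left)

lemma finite_stab: "finite (stab c)"
  by (rule finite_subset[OF _ finite_roots_unity[OF m]]) (auto simp: stab_def)

lemma one_in_stab: "1 \<in> stab c"
  by (simp add: stab_def)

lemma card_stab_pos: "1 \<le> card (stab c)"
  using finite_stab one_in_stab by (metis One_nat_def Suc_leI card_gt_0_iff empty_iff)

lemma stab_eq_roots: "stab c = {\<zeta>. \<zeta> ^ card (stab c) = 1}"
proof (rule closed_under_mult_eq_roots)
  show "stab c \<noteq> {}"
    using one_in_stab by blast
  show "0 \<notin> stab c"
    using root_nonzero by (auto simp: stab_def)
  fix x y assume x: "x \<in> stab c" and y: "y \<in> stab c"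
  \<comment> \<open>This sum is \<open>(x * y - 1) * c\<close>.\<close>
  have "x * ((y - 1) * c) + (x - 1) * c \<in> torus_lattice 1 \<tau>"
    using x y rot by (intro torus_lattice_add) (auto simp: stab_def)
  then show "x * y \<in> stab c"
    using x y by (simp add: stab_def power_mult_distrib algebra_simps)
qed (rule finite_stab)

text \<open>Conjugate stabilizers have the same rotation parts because rotations about the origin
  commute; the reverse inclusion follows from the symmetry of the orbit relation.\<close>

lemma stab_orbit_subset:
  assumes "\<zeta> ^ m = 1" "l \<in> torus_lattice 1 \<tau>"
  shows "stab c \<subseteq> stab (\<zeta> * c + l)"
proof
  fix x assume x: "x \<in> stab c"
  have "\<zeta> * ((x - 1) * c) + (x * l - l) \<in> torus_lattice 1 \<tau>"
    using x assms rot by (intro torus_lattice_add torus_lattice_diff) (auto simp: stab_def)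
  then show "x \<in> stab (\<zeta> * c + l)"
    using x by (simp add: stab_def algebra_simps)
qed

lemma card_roots: "card {\<zeta>::complex. \<zeta> ^ m = 1} = m"
  using m by (simp add: card_roots_unity_eq)

end

locale orbit_cover = lattice_action \<tau> m +
  E: orbit_map k \<tau> 1 E S + F: orbit_map 1 \<tau> m F T
  for \<tau> m k and E :: "complex \<Rightarrow> 'a::t2_space" and S and F :: "complex \<Rightarrow> 'b::t2_space" and T
begin

lemma E_eq_iff: "E z = E w \<longleftrightarrow> w - z \<in> torus_lattice k \<tau>"
proof -
  have "E z = E w \<longleftrightarrow> (\<exists>l. l \<in> torus_lattice k \<tau> \<and> w = z + l)"
    using E.fib[of z w] by simp
  also have "\<dots> \<longleftrightarrow> w - z \<in> torus_lattice k \<tau>"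
    by (metis add_diff_cancel_left' diff_add_cancel add.commute)
  finally show ?thesis .
qed

text \<open>The chosen preimage is immaterial: \<open>F\<close> is invariant under the full lattice,
  which contains the differences of preimages under \<open>E\<close>.\<close>

definition f where "f s = F (SOME z. E z = s)"

lemma f_E [simp]: "f (E z) = F z"
proof -
  define w where "w = (SOME w. E w = E z)"
  have "E w = E z"
    unfolding w_def by (rule someI) (rule refl)
  then have "z - w \<in> torus_lattice 1 \<tau>"
    using E_eq_iff torus_lattice_subset by blast
  then have "F (w + (z - w)) = F w"
    by (rule F.periodic)
  then show ?thesis
    by (simp add: f_def flip: w_def)
qed

lemma stab_fibre: "F z = F w \<Longrightarrow> stab z = stab w"
  using stab_orbit_subset F.fib by (metis subset_antisym)

text \<open>Near c, equal values of F mean a rotation about c by an element of the stabilizer. The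
  stabilizer is the full group of e-th roots of unity, so these are the fibres of the e-th
  power.\<close>

lemma power_model_f: "power_model_at S T f (E c) (card (stab c))"
proof -
  obtain r1 where r1: "0 < r1" "\<And>u v. u \<in> ball c r1 \<Longrightarrow> v \<in> ball c r1 \<Longrightarrow> E u = E v \<Longrightarrow> u = v"
    using E.local_fibres[of c] by auto
  obtain r2 where r2: "0 < r2" "\<And>u v. u \<in> ball c r2 \<Longrightarrow> v \<in> ball c r2 \<Longrightarrow> F u = F v \<Longrightarrow>
       \<exists>\<zeta>\<in>stab c. v - c = \<zeta> * (u - c)"
    using F.local_fibres[of c] unfolding stab_def by blast
  let ?e = "card (stab c)"
  show ?thesis
  proof (rule power_model_at_quotient)
    show "0 < min r1 r2"
      using r1 r2 by simp
    show "inj_on E (ball c (min r1 r2))"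
      by (intro inj_onI r1(2)) auto
    show "F u = F v \<longleftrightarrow> (u - c) ^ ?e = (v - c) ^ ?e"
      if uv: "u \<in> ball c (min r1 r2)" "v \<in> ball c (min r1 r2)" for u v
    proof
      assume "F u = F v"
      then obtain \<zeta> where "\<zeta> \<in> stab c" "v - c = \<zeta> * (u - c)"
        using r2(2)[of u v] uv by auto
      moreover from this have "\<zeta> ^ ?e = 1"
        using stab_eq_roots by blast
      ultimately show "(u - c) ^ ?e = (v - c) ^ ?e"
        by (simp add: power_mult_distrib)
    next
      assume eq: "(u - c) ^ ?e = (v - c) ^ ?e"
      show "F u = F v"
      proof (cases "u = c")
        case True
        then have "v = c"
          using eq card_stab_pos[of c] by (simp add: power_0_left split: if_splits)
        with True show ?thesis by simp
      next
        case False
        define \<zeta> where "\<zeta> = (v - c) / (u - c)"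
        have "\<zeta> ^ ?e = 1"
          using eq False card_stab_pos[of c] by (auto simp: \<zeta>_def power_divide power_0_left)
        then have \<zeta>: "\<zeta> \<in> stab c"
          using stab_eq_roots by blast
        have "v - c = \<zeta> * (u - c)"
          using False by (simp add: \<zeta>_def)
        then have "v = \<zeta> * u + - ((\<zeta> - 1) * c)"
          by (simp add: algebra_simps)
        then show ?thesis
          using \<zeta> F.fib torus_lattice_minus unfolding stab_def by blast
      qed
    qed
  qed (fact card_stab_pos E.cont F.cont E.open_map F.open_map f_E)+
qed

lemma local_degree_f: "local_degree S T f (E c) = card (stab c)"
  by (rule local_degree_eq) (rule power_model_f)

lemma branched_cover_f: "branched_cover S T f"
  unfolding branched_cover_def using power_model_f E.onto F.onto by fastforce

lemma branching_points_f: "branching_points S T f = F ` {c. 1 < card (stab c)}"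
proof -
  have S: "x \<in> S \<longleftrightarrow> (\<exists>c. x = E c)" and T: "F c \<in> T" for x c
    using E.onto F.onto by auto
  have "(\<exists>x\<in>S. f x = y \<and> 1 < local_degree S T f x) \<longleftrightarrow> (\<exists>c. F c = y \<and> 1 < card (stab c))" for y
    unfolding S Bex_def by (metis f_E local_degree_f)
  then show ?thesis
    using T by (auto simp: branching_points_def)
qed

text \<open>On the torus multiples of \<tau> act trivially and integers act modulo k, so k
  translations per rotation exhaust the fibre, possibly with repetitions.\<close>

lemma fibre_f: "{x \<in> S. f x = F c} = (\<lambda>(\<zeta>, j). E (\<zeta> * c + of_nat j)) ` ({\<zeta>. \<zeta> ^ m = 1} \<times> {..<k})"
  (is "_ = ?R")
proof (intro equalityI subsetI)
  fix x assume "x \<in> {x \<in> S. f x = F c}"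
  then obtain w where w: "x = E w" "F c = F w"
    using E.onto by force
  then obtain \<zeta> l where z: "\<zeta> ^ m = 1" "l \<in> torus_lattice 1 \<tau>" "w = \<zeta> * c + l"
    using F.fib by blast
  then obtain i j where ij: "l = of_int i + of_int j * \<tau>"
    unfolding torus_lattice_def by auto
  define n where "n = nat (i mod int k)"
  have n: "n < k" "int n = i mod int k"
    using E.k by (auto simp: n_def nat_less_iff)
  have i: "i = (i div int k) * int k + int n"
    using n by simp
  have "of_int i = (of_int (i div int k) * of_nat k + of_nat n :: complex)"
    by (subst i) simp
  then have "w - (\<zeta> * c + of_nat n) = of_int (i div int k) * of_nat k + of_int j * \<tau>"
    by (simp add: z ij)
  then have "E (\<zeta> * c + of_nat n) = x"
    using w E_eq_iff torus_latticeI by metis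
  then show "x \<in> ?R"
    using z n by force
next
  fix x assume "x \<in> ?R"
  then obtain \<zeta> j where x: "\<zeta> ^ m = 1" "x = E (\<zeta> * c + of_nat j)"
    by auto
  have "(of_nat j :: complex) \<in> torus_lattice 1 \<tau>"
    by (rule torus_latticeI[of _ "int j" _ 0]) simp
  then have "F (\<zeta> * c + of_nat j) = F c"
    using x F.fib by metis
  then show "x \<in> {x \<in> S. f x = F c}"
    using x E.onto by auto
qed

text \<open>Orbit-stabilizer count: the k m pairs (\<zeta>, j) are mapped onto the fibre, and each
  point is hit as often as the stabilizer has elements.\<close>

lemma card_fibre_f: "card {x \<in> S. f x = F c} * card (stab c) = k * m"
proof -
  define A where "A = {\<zeta>::complex. \<zeta> ^ m = 1} \<times> {..<k}"
  define h where "h = (\<lambda>(\<zeta>, j). E (\<zeta> * c + of_nat j))"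
  have A: "finite A" "card A = k * m"
    using finite_roots_unity[OF m] card_roots by (auto simp: A_def card_cartesian_product)
  have one: "card {a \<in> A. h a = y} = card (stab c)" if y: "y \<in> h ` A" for y
  proof -
    obtain \<zeta>0 j0 where 0: "\<zeta>0 ^ m = 1" "j0 < k" "y = E (\<zeta>0 * c + of_nat j0)"
      using y by (auto simp: A_def h_def)
    have \<zeta>0: "\<zeta>0 \<noteq> 0"
      using root_nonzero 0 by blast
    have "bij_betw (\<lambda>(\<zeta>, j). \<zeta> / \<zeta>0) {a \<in> A. h a = y} (stab c)"
      unfolding bij_betw_def
    proof
      \<comment> \<open>A rotation determines its translation, as j and j' agree modulo k.\<close>
      have "j = j'" if "j < k" "j' < k" "E (\<zeta> * c + of_nat j) = E (\<zeta> * c + of_nat j')" for \<zeta> j j'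
      proof -
        have "of_nat j' - of_nat j \<in> torus_lattice k \<tau>"
          using that(3) E_eq_iff by simp
        then have "int k dvd int j' - int j"
          using of_int_in_torus_lattice[OF \<tau> E.k, of "int j' - int j"] by simp
        then have "int j' mod int k = int j mod int k"
          by (simp add: mod_eq_dvd_iff)
        then show ?thesis
          using that by simp
      qed
      then show "inj_on (\<lambda>(\<zeta>, j). \<zeta> / \<zeta>0) {a \<in> A. h a = y}"
        using \<zeta>0 by (auto simp: inj_on_def A_def h_def)
      show "(\<lambda>(\<zeta>, j). \<zeta> / \<zeta>0) ` {a \<in> A. h a = y} = stab c"
      proof (intro equalityI subsetI)
        fix s assume "s \<in> (\<lambda>(\<zeta>, j). \<zeta> / \<zeta>0) ` {a \<in> A. h a = y}"
        then obtain a where a: "a \<in> A" "h a = y" "s = (\<lambda>(\<zeta>, j). \<zeta> / \<zeta>0) a"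
          by blast
        obtain \<zeta> j where "a = (\<zeta>, j)"
          by (cases a)
        with a 0 have z: "s = \<zeta> / \<zeta>0" "\<zeta> ^ m = 1" "E (\<zeta>0 * c + of_nat j0) = E (\<zeta> * c + of_nat j)"
          by (simp_all add: A_def h_def)
        define l where "l = (\<zeta> * c + of_nat j) - (\<zeta>0 * c + of_nat j0)"
        have l: "l \<in> torus_lattice 1 \<tau>"
          using z(3) E_eq_iff torus_lattice_subset unfolding l_def by blast
        \<comment> \<open>Removing the integer shifts from l leaves
          \<open>(\<zeta> - \<zeta>0) * c\<close>; rotating back by \<open>inverse \<zeta>0\<close>
          turns it into \<open>(s - 1) * c\<close>.\<close>
        have "of_int (int j0 - int j) \<in> torus_lattice 1 \<tau>"
          by (rule torus_latticeI[of _ "int j0 - int j" _ 0]) simp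
        then have "l + of_int (int j0 - int j) \<in> torus_lattice 1 \<tau>"
          using l torus_lattice_add by blast
        moreover have "inverse \<zeta>0 ^ m = 1"
          using 0 by (simp add: power_inverse)
        ultimately have "inverse \<zeta>0 * (l + of_int (int j0 - int j)) \<in> torus_lattice 1 \<tau>"
          using rot by blast
        moreover have "inverse \<zeta>0 * (l + of_int (int j0 - int j)) = (s - 1) * c"
          using \<zeta>0 by (simp add: l_def z(1) field_simps)
        ultimately show "s \<in> stab c"
          using z 0 by (simp add: stab_def power_divide)
      next
        fix s assume s: "s \<in> stab c"
        have "F (s * \<zeta>0 * c) = F c" "F (\<zeta>0 * c + of_nat j0) = F c"
        proof -
          have "(s * \<zeta>0) ^ m = 1"
            using s 0 by (simp add: stab_def power_mult_distrib)
          then show "F (s * \<zeta>0 * c) = F c"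
            using F.fib[of c "s * \<zeta>0 * c"] torus_lattice_0 by (metis add.right_neutral)
          have "(of_nat j0 :: complex) \<in> torus_lattice 1 \<tau>"
            by (rule torus_latticeI[of _ "int j0" _ 0]) simp
          then show "F (\<zeta>0 * c + of_nat j0) = F c"
            using 0 F.fib by metis
        qed
        \<comment> \<open>This is the vector from \<open>s * \<zeta>0 * c\<close> to the given
          representative of y; reducing its integer coordinate modulo k yields the translation n
          that belongs to the rotation \<open>s * \<zeta>0\<close>.\<close>
        have "\<zeta>0 * ((1 - s) * c) + of_nat j0 \<in> torus_lattice 1 \<tau>"
        proof (rule torus_lattice_add)
          have "(1 - s) * c \<in> torus_lattice 1 \<tau>"
            using s torus_lattice_minus[of "(s - 1) * c"] by (simp add: stab_def algebra_simps)
          then show "\<zeta>0 * ((1 - s) * c) \<in> torus_lattice 1 \<tau>"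
            using rot 0 by blast
          show "of_nat j0 \<in> torus_lattice 1 \<tau>"
            by (rule torus_latticeI[of _ "int j0" _ 0]) simp
        qed
        then obtain i b where ib: "\<zeta>0 * ((1 - s) * c) + of_nat j0 = of_int i + of_int b * \<tau>"
          unfolding torus_lattice_def by auto
        define n where "n = nat (i mod int k)"
        have n: "n < k" "int n = i mod int k"
          using E.k by (auto simp: n_def nat_less_iff)
        have i: "i = (i div int k) * int k + int n"
          using n by simp
        have "of_int i = (of_int (i div int k) * of_nat k + of_nat n :: complex)"
          by (subst i) simp
        then have "(\<zeta>0 * c + of_nat j0) - (s * \<zeta>0 * c + of_nat n) =
            of_int (i div int k) * of_nat k + of_int b * \<tau>"
          using ib by (simp add: algebra_simps)
        then have "E (s * \<zeta>0 * c + of_nat n) = y"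
          using 0 E_eq_iff torus_latticeI by metis
        moreover have "(s * \<zeta>0) ^ m = 1"
          using s 0 by (simp add: stab_def power_mult_distrib)
        ultimately have "(s * \<zeta>0, n) \<in> {a \<in> A. h a = y}"
          using n by (simp add: A_def h_def)
        then show "s \<in> (\<lambda>(\<zeta>, j). \<zeta> / \<zeta>0) ` {a \<in> A. h a = y}"
          using \<zeta>0 by (intro image_eqI[of _ _ "(s * \<zeta>0, n)"]) auto
      qed
    qed
    then show ?thesis
      by (rule bij_betw_same_card)
  qed
  have "card A = (\<Sum>y\<in>h ` A. \<Sum>a\<in>{a \<in> A. h a = y}. 1)"
    using sum.image_gen[OF A(1), of "\<lambda>_. 1::nat" h] by simp
  also have "\<dots> = (\<Sum>y\<in>h ` A. card (stab c))"
    using one by (intro sum.cong) auto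
  finally show ?thesis
    using A by (simp add: fibre_f flip: A_def h_def)
qed

end

section \<open>The torus as an image of the plane\<close>

lemma cis_2pi_eq_iff: "cis (2 * pi * a) = cis (2 * pi * b) \<longleftrightarrow> a - b \<in> \<int>"
proof
  assume "cis (2 * pi * a) = cis (2 * pi * b)"
  then have "sin (2 * pi * a) = sin (2 * pi * b) \<and> cos (2 * pi * a) = cos (2 * pi * b)"
    by (simp add: complex_eq_iff)
  then obtain n :: int where "2 * pi * a = 2 * pi * b + 2 * pi * n"
    using sin_cos_eq_iff by blast
  then have "2 * pi * (a - b) = 2 * pi * n"
    by (simp add: algebra_simps)
  then show "a - b \<in> \<int>"
    by simp
next
  assume "a - b \<in> \<int>"
  then obtain n where "a = b + of_int n"
    by (metis Ints_cases add.commute diff_add_cancel)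
  then have "2 * pi * a = 2 * pi * b + 2 * pi * n"
    by (simp add: algebra_simps)
  then have "sin (2 * pi * a) = sin (2 * pi * b) \<and> cos (2 * pi * a) = cos (2 * pi * b)"
    using sin_cos_eq_iff by blast
  then show "cis (2 * pi * a) = cis (2 * pi * b)"
    by (simp add: complex_eq_iff)
qed

lemma unit_complex_cis_2pi:
  assumes "cmod z = 1"
  obtains x where "z = cis (2 * pi * x)"
proof -
  have "z = cis (2 * pi * (Arg z / (2 * pi)))"
    using assms rcis_cmod_Arg[of z] by (simp add: rcis_def)
  then show ?thesis
    using that by blast
qed

lemma torus_parametrization:
  assumes \<tau>: "Im \<tau> \<noteq> 0" and k: "1 \<le> k"
  obtains E where "orbit_map k \<tau> 1 E (genus_surface 1)"
proof -
  let ?S = "(sphere 0 1 :: complex set) \<times> (sphere 0 1 :: complex set)"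
  obtain h h' where hom: "homeomorphism ?S (genus_surface 1) h h'"
    using genus_surface_1 homeomorphic_sym unfolding homeomorphic_def by blast
  \<comment> \<open>Dividing the first coordinate by k gives both angles period 1, so the periods of
    \<open>e\<close> are exactly the sublattice.\<close>
  define e where "e z = (cis (2 * pi * (coord1 \<tau> z / k)), cis (2 * pi * coord2 \<tau> z))" for z
  have eS: "e z \<in> ?S" for z
    by (simp add: e_def)
  have inj: "inj_on h ?S"
    using homeomorphism_apply1[OF hom] by (rule inj_on_inverseI)
  have "orbit_map k \<tau> 1 (h \<circ> e) (genus_surface 1)"
  proof
    have "continuous_on UNIV e"
      unfolding e_def by (intro continuous_intros) (use k in auto)
    then show "continuous_on UNIV (h \<circ> e)"
      using eS hom by (intro continuous_on_compose)
        (auto simp: homeomorphism_def intro: continuous_on_subset)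
    have "range e = ?S"
    proof (intro equalityI subsetI)
      fix p assume "p \<in> ?S"
      then obtain u v where p: "p = (u, v)" "cmod u = 1" "cmod v = 1"
        by auto
      obtain x y where xy: "u = cis (2 * pi * x)" "v = cis (2 * pi * y)"
        using unit_complex_cis_2pi p by metis
      have "e (of_real (k * x) + of_real y * \<tau>) = p"
        unfolding e_def coords_of_real[OF \<tau>] using k by (simp add: p xy)
      then show "p \<in> range e"
        by blast
    qed (use eS in blast)
    then show "range (h \<circ> e) = genus_surface 1"
      using hom by (metis homeomorphism_def image_comp)
    fix z w
    have "(h \<circ> e) z = (h \<circ> e) w \<longleftrightarrow> e w = e z"
      using inj eS by (metis comp_apply inj_on_eq_iff)
    also have "\<dots> \<longleftrightarrow> w - z \<in> torus_lattice k \<tau>"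
      by (simp only: e_def prod.inject cis_2pi_eq_iff torus_lattice_iff_coords[OF \<tau> k] coords_add
          diff_divide_distrib)
    also have "\<dots> \<longleftrightarrow> (\<exists>\<zeta> l. \<zeta> ^ 1 = 1 \<and> l \<in> torus_lattice k \<tau> \<and> w = \<zeta> * z + l)"
      by (auto intro!: exI[of _ "w - z"])
    finally show "(h \<circ> e) z = (h \<circ> e) w \<longleftrightarrow>
      (\<exists>\<zeta> l. \<zeta> ^ 1 = 1 \<and> l \<in> torus_lattice k \<tau> \<and> w = \<zeta> * z + l)" .
  qed (use \<tau> k in auto)
  then show ?thesis
    using that by blast
qed

context orbit_cover
begin

lemma local_degrees_over_f:
  "local_degrees_over S T f (F c) = replicate_mset (k * m div card (stab c)) (card (stab c))"
proof -
  define X where "X = {x \<in> S. f x = F c}"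
  have "local_degree S T f x = card (stab c)" if x: "x \<in> X" for x
  proof -
    obtain z where "x = E z" "F z = F c"
      using x E.onto by (force simp: X_def)
    then show ?thesis
      using local_degree_f stab_fibre by metis
  qed
  moreover have "finite X"
    unfolding X_def fibre_f using finite_roots_unity[OF m] by auto
  ultimately have "image_mset (local_degree S T f) (mset_set X) =
      image_mset (\<lambda>_. card (stab c)) (mset_set X)"
    by (intro image_mset_cong) auto
  then have "local_degrees_over S T f (F c) = replicate_mset (card X) (card (stab c))"
    by (simp add: local_degrees_over_def image_mset_const_eq flip: X_def)
  also have "card X = k * m div card (stab c)"
    using card_fibre_f[of c, symmetric] card_stab_pos[of c] by (simp add: X_def)
  finally show ?thesis .
qed

lemma has_cover_degree_f: "has_cover_degree S T f (k * m)"
  unfolding has_cover_degree_def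
proof
  fix y assume y: "y \<in> T - branching_points S T f"
  then obtain c where c: "y = F c"
    using F.onto by auto
  then have "card (stab c) = 1"
    using y card_stab_pos[of c] by (force simp: branching_points_f)
  moreover have "finite {x \<in> S. f x = F c}"
    unfolding fibre_f using finite_roots_unity[OF m] by auto
  ultimately show "finite {x \<in> S. f x = y} \<and> card {x \<in> S. f x = y} = k * m"
    using card_fibre_f[of c] by (simp add: c)
qed

end

text \<open>C represents, once each, the orbits with nontrivial stabilizer. These are the branching
  points, so the partitions are read off from C.\<close>

lemma (in lattice_action) realizable_orbit_map:
  assumes F: "orbit_map 1 \<tau> m F (genus_surface g)" and k: "1 \<le> k"
    and C: "finite C" "inj_on F C" "F ` C = F ` {c. 1 < card (stab c)}"
    and P: "P = image_mset (\<lambda>c. replicate_mset (k * m div card (stab c)) (card (stab c))) (mset_set C)"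
  shows "realizable \<lparr>source_genus = 1, target_genus = g, cover_degree = k * m, partitions = P\<rparr>"
proof -
  obtain E where E: "orbit_map k \<tau> 1 E (genus_surface 1)"
    using torus_parametrization[OF \<tau> k] by blast
  interpret orbit_cover \<tau> m k E "genus_surface 1" F "genus_surface g"
    using E F lattice_action_axioms by (simp add: orbit_cover_def)
  have "branching_points (genus_surface 1) (genus_surface g) f = F ` C"
    by (simp add: branching_points_f C)
  moreover have "image_mset (local_degrees_over (genus_surface 1) (genus_surface g) f) (mset_set (F ` C)) = P"
    by (simp add: P image_mset_mset_set[OF C(2), symmetric] multiset.map_comp comp_def local_degrees_over_f)
  ultimately show ?thesis
    using branched_cover_f has_cover_degree_f C(1)
    unfolding realizable_def Let_def by (intro exI[of _ f]) simp
qed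

section \<open>Explicit orbit maps onto the sphere\<close>

lemma sphere_Times_iff: "(w, t) \<in> sphere (0 :: complex \<times> real) 1 \<longleftrightarrow> (cmod w)\<^sup>2 + t\<^sup>2 = 1"
  by (simp add: norm_Pair)

text \<open>By \<open>star\<close> no ray from the origin carries two image points, so normalizing
  preserves the fibres; by \<open>onto\<close> every ray carries one.\<close>

lemma orbit_map_radial:
  fixes G :: "complex \<Rightarrow> complex \<times> real"
  assumes \<tau>: "Im \<tau> \<noteq> 0" and m: "1 \<le> m" and cont: "continuous_on UNIV G"
    and nz: "\<And>z. G z \<noteq> 0" and star: "\<And>z w s. 0 < s \<Longrightarrow> s < 1 \<Longrightarrow> G w \<noteq> s *\<^sub>R G z"
    and onto: "\<And>v. v \<noteq> 0 \<Longrightarrow> \<exists>s>0. \<exists>z. G z = s *\<^sub>R v"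
    and fib: "\<And>z w. G z = G w \<longleftrightarrow> (\<exists>\<zeta> l. \<zeta> ^ m = 1 \<and> l \<in> torus_lattice 1 \<tau> \<and> w = \<zeta> * z + l)"
  shows "orbit_map 1 \<tau> m (\<lambda>z. sgn (G z)) (sphere 0 1)"
proof
  show "continuous_on UNIV (\<lambda>z. sgn (G z))"
    using cont nz by (intro continuous_intros) auto
  show "range (\<lambda>z. sgn (G z)) = sphere 0 1"
  proof (intro equalityI subsetI)
    fix v :: "complex \<times> real" assume v: "v \<in> sphere 0 1"
    then have v1: "norm v = 1" by simp
    then obtain s z where "s > 0" "G z = s *\<^sub>R v"
      using onto[of v] by fastforce
    then have "sgn (G z) = v"
      using v1 by (simp add: sgn_div_norm)
    then show "v \<in> range (\<lambda>z. sgn (G z))"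
      by blast
  qed (use nz in \<open>auto simp: norm_sgn\<close>)
  fix z w
  have "sgn (G z) = sgn (G w) \<longleftrightarrow> G z = G w"
  proof
    assume sgn: "sgn (G z) = sgn (G w)"
    define s where "s = norm (G w) / norm (G z)"
    have s: "0 < s"
      using nz by (simp add: s_def)
    have w: "G w = s *\<^sub>R G z"
    proof -
      have "G w = norm (G w) *\<^sub>R sgn (G w)"
        using nz by (simp add: sgn_div_norm)
      also have "\<dots> = norm (G w) *\<^sub>R sgn (G z)"
        by (simp only: sgn)
      also have "\<dots> = s *\<^sub>R G z"
        by (simp add: s_def divide_inverse sgn_div_norm)
      finally show ?thesis .
    qed
    then have "G z = (1 / s) *\<^sub>R G w"
      using s by simp
    with w star[of s w z] star[of "1 / s" z w] s have "s = 1"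
      by (cases s "1::real" rule: linorder_cases) auto
    with w show "G z = G w" by simp
  qed simp
  then show "sgn (G z) = sgn (G w) \<longleftrightarrow>
      (\<exists>\<zeta> l. \<zeta> ^ m = 1 \<and> l \<in> torus_lattice 1 \<tau> \<and> w = \<zeta> * z + l)"
    using fib by simp
qed (use \<tau> m in auto)

text \<open>The quotient by the half turn \<open>(w, t) \<mapsto> (- w, t)\<close>: the argument of
  w is doubled, and dividing by the modulus keeps the point on the sphere. For w = 0 division by
  zero returns 0, which is the continuous extension.\<close>

definition angle_double :: "complex \<times> real \<Rightarrow> complex \<times> real" where
  "angle_double p = ((fst p)\<^sup>2 / of_real (cmod (fst p)), snd p)"

lemma cmod_square_div: "cmod (w\<^sup>2 / of_real (cmod w)) = cmod w"
  by (cases "w = 0") (simp_all add: norm_divide norm_mult power2_eq_square)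

lemma continuous_square_div_cmod: "continuous_on UNIV (\<lambda>w::complex. w\<^sup>2 / of_real (cmod w))"
proof -
  have "isCont (\<lambda>w::complex. w\<^sup>2 / of_real (cmod w)) w" for w
  proof (cases "w = 0")
    case True
    have "((\<lambda>w::complex. w\<^sup>2 / of_real (cmod w)) \<longlongrightarrow> 0) (at 0)"
    proof (rule tendsto_norm_zero_cancel)
      show "((\<lambda>w::complex. cmod (w\<^sup>2 / of_real (cmod w))) \<longlongrightarrow> 0) (at 0)"
        unfolding cmod_square_div by (auto intro!: tendsto_eq_intros)
    qed
    then show ?thesis
      using True by (simp add: isCont_def)
  qed (auto intro!: continuous_intros)
  then show ?thesis
    by (simp add: continuous_on_eq_continuous_at)
qed

lemma square_div_eq_iff:
  "w\<^sup>2 / of_real (cmod w) = v\<^sup>2 / of_real (cmod v) \<longleftrightarrow> v = w \<or> v = - w"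
proof
  assume eq: "w\<^sup>2 / of_real (cmod w) = v\<^sup>2 / of_real (cmod v)"
  then have "cmod w = cmod v"
    by (metis cmod_square_div)
  with eq have "w\<^sup>2 = v\<^sup>2"
    by (cases "w = 0") auto
  then show "v = w \<or> v = - w"
    by (auto simp: power2_eq_iff)
qed auto

text \<open>The roots of unity of order 2 m are the m-th roots and their multiples by \<rho>. As
  \<rho> acts on the sphere as the half turn, dividing by the half turn adds precisely the second
  coset.\<close>

lemma orbit_map_angle_double:
  assumes F: "orbit_map 1 \<tau> m F (sphere 0 1)" and \<rho>: "\<rho> ^ m = - 1"
    and half: "\<And>z. F (\<rho> * z) = (- fst (F z), snd (F z))"
  shows "orbit_map 1 \<tau> (2 * m) (\<lambda>z. angle_double (F z)) (sphere 0 1)"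
proof -
  interpret F: orbit_map 1 \<tau> m F "sphere 0 1"
    by (rule F)
  have sph: "angle_double p \<in> sphere 0 1 \<longleftrightarrow> p \<in> sphere 0 1" for p
    by (cases p) (simp only: angle_double_def fst_conv snd_conv sphere_Times_iff cmod_square_div)
  show ?thesis
  proof
    have "continuous_on UNIV angle_double"
      unfolding angle_double_def
      by (intro continuous_intros continuous_on_compose2[OF continuous_square_div_cmod]) auto
    then show "continuous_on UNIV (\<lambda>z. angle_double (F z))"
      by (rule continuous_on_compose2[OF _ F.cont]) auto
    show "range (\<lambda>z. angle_double (F z)) = sphere 0 1"
    proof (intro equalityI subsetI)
      fix p assume p: "p \<in> sphere (0 :: complex \<times> real) 1"
      \<comment> \<open>The preimage must have the modulus of \<open>fst p\<close> and half its
        argument: a square root of \<open>fst p\<close> times its modulus.\<close>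
      define w where "w = of_real (sqrt (cmod (fst p))) * csqrt (fst p)"
      have w: "cmod w = cmod (fst p)"
        by (simp add: w_def norm_mult)
      have "w\<^sup>2 = of_real (cmod (fst p)) * fst p"
        by (simp add: w_def power_mult_distrib flip: of_real_power)
      then have "angle_double (w, snd p) = p"
        using w by (cases "fst p = 0") (auto simp: angle_double_def prod_eq_iff)
      moreover from this have "(w, snd p) \<in> sphere 0 1"
        using sph p by metis
      ultimately show "p \<in> range (\<lambda>z. angle_double (F z))"
        using F.onto by (metis image_iff rangeI)
    next
      fix p assume "p \<in> range (\<lambda>z. angle_double (F z))"
      then show "p \<in> sphere 0 1"
        using F.onto sph by blast
    qed
    fix z w
    have "angle_double (F z) = angle_double (F w) \<longleftrightarrow> F w = F z \<or> F w = F (\<rho> * z)"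
      by (auto simp: angle_double_def half square_div_eq_iff prod_eq_iff)
    also have "\<dots> \<longleftrightarrow> (\<exists>\<zeta> l. \<zeta> ^ m = 1 \<and> l \<in> torus_lattice 1 \<tau> \<and> w = \<zeta> * z + l) \<or>
        (\<exists>\<zeta> l. \<zeta> ^ m = 1 \<and> l \<in> torus_lattice 1 \<tau> \<and> w = \<zeta> * (\<rho> * z) + l)"
      using F.fib[of z w] F.fib[of "\<rho> * z" w] by metis
    also have "\<dots> \<longleftrightarrow> (\<exists>\<zeta> l. \<zeta> ^ (2 * m) = 1 \<and> l \<in> torus_lattice 1 \<tau> \<and> w = \<zeta> * z + l)"
    proof -
      have root: "\<zeta> ^ (2 * m) = 1 \<longleftrightarrow> \<zeta> ^ m = 1 \<or> (\<exists>\<xi>. \<xi> ^ m = 1 \<and> \<zeta> = \<xi> * \<rho>)" for \<zeta>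
      proof
        assume "\<zeta> ^ (2 * m) = 1"
        then have "\<zeta> ^ m = 1 \<or> \<zeta> ^ m = - 1"
          by (metis power2_eq_1_iff power_mult mult.commute)
        moreover have "\<exists>\<xi>. \<xi> ^ m = 1 \<and> \<zeta> = \<xi> * \<rho>" if "\<zeta> ^ m = - 1"
        proof (intro exI conjI)
          have "\<rho> \<noteq> 0"
            using \<rho> F.m by (auto simp: power_0_left)
          then show "\<zeta> = \<zeta> / \<rho> * \<rho>" by simp
          show "(\<zeta> / \<rho>) ^ m = 1"
            using that \<rho> by (simp add: power_divide)
        qed
        ultimately show "\<zeta> ^ m = 1 \<or> (\<exists>\<xi>. \<xi> ^ m = 1 \<and> \<zeta> = \<xi> * \<rho>)" by blast
      next
        assume "\<zeta> ^ m = 1 \<or> (\<exists>\<xi>. \<xi> ^ m = 1 \<and> \<zeta> = \<xi> * \<rho>)"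
        then have "\<zeta> ^ m = 1 \<or> \<zeta> ^ m = - 1"
          using \<rho> by (auto simp: power_mult_distrib)
        then show "\<zeta> ^ (2 * m) = 1"
          by (auto simp: power_mult mult.commute[of 2 m])
      qed
      show ?thesis
      proof (intro iffI; elim disjE exE conjE)
        fix \<zeta> l assume "\<zeta> ^ m = 1" "l \<in> torus_lattice 1 \<tau>" "w = \<zeta> * z + l"
        then show "\<exists>\<zeta> l. \<zeta> ^ (2 * m) = 1 \<and> l \<in> torus_lattice 1 \<tau> \<and> w = \<zeta> * z + l"
          using root by blast
      next
        fix \<zeta> l assume "\<zeta> ^ m = 1" "l \<in> torus_lattice 1 \<tau>" "w = \<zeta> * (\<rho> * z) + l"
        then show "\<exists>\<zeta> l. \<zeta> ^ (2 * m) = 1 \<and> l \<in> torus_lattice 1 \<tau> \<and> w = \<zeta> * z + l"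
          using root[of "\<zeta> * \<rho>"] by (intro exI[of _ "\<zeta> * \<rho>"] exI[of _ l]) (auto simp: mult.assoc)
      next
        fix \<zeta> l assume "\<zeta> ^ (2 * m) = 1" "l \<in> torus_lattice 1 \<tau>" "w = \<zeta> * z + l"
        then show "(\<exists>\<zeta> l. \<zeta> ^ m = 1 \<and> l \<in> torus_lattice 1 \<tau> \<and> w = \<zeta> * z + l) \<or>
            (\<exists>\<zeta> l. \<zeta> ^ m = 1 \<and> l \<in> torus_lattice 1 \<tau> \<and> w = \<zeta> * (\<rho> * z) + l)"
          unfolding root by (auto simp: mult.assoc)
      qed
    qed
    finally show "angle_double (F z) = angle_double (F w) \<longleftrightarrow>
        (\<exists>\<zeta> l. \<zeta> ^ (2 * m) = 1 \<and> l \<in> torus_lattice 1 \<tau> \<and> w = \<zeta> * z + l)" .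
  qed (use F.\<tau> F.m in auto)
qed

section \<open>The square lattice: sphere as a pillow\<close>

lemma lattice_cis_iff:
  assumes "Im \<tau> \<noteq> 0"
  shows "w - z \<in> torus_lattice 1 \<tau> \<longleftrightarrow>
    cis (2 * pi * coord1 \<tau> w) = cis (2 * pi * coord1 \<tau> z) \<and>
    cis (2 * pi * coord2 \<tau> w) = cis (2 * pi * coord2 \<tau> z)"
  by (simp add: cis_2pi_eq_iff torus_lattice_iff_coords[OF assms])

text \<open>All three functions cos a, cos b, sin a sin b are even in (a, b). The first two enter
  through their difference and sum because multiplication by \<i> exchanges them and negates the
  third: it becomes the half turn that negates the complex component.\<close>

definition pillow :: "complex \<Rightarrow> complex \<times> real" where
  "pillow z = (let a = 2 * pi * Re z; b = 2 * pi * Im z in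
     (Complex (cos a - cos b) (sin a * sin b), cos a + cos b))"

lemma pillow_eq_iff:
  "pillow z = s *\<^sub>R (Complex (\<alpha> - \<beta>) t, \<alpha> + \<beta>) \<longleftrightarrow>
     cos (2 * pi * Re z) = s * \<alpha> \<and> cos (2 * pi * Im z) = s * \<beta> \<and>
     sin (2 * pi * Re z) * sin (2 * pi * Im z) = s * t"
proof -
  have "(x - y = s * (\<alpha> - \<beta>) \<and> T \<and> x + y = s * (\<alpha> + \<beta>)) \<longleftrightarrow> x = s * \<alpha> \<and> y = s * \<beta> \<and> T"
    for x y and T
    by (auto simp: algebra_simps)
  then show ?thesis
    by (simp add: pillow_def Let_def complex_eq_iff conj_assoc)
qed

text \<open>Along the ray, right side minus left side starts at 1 and is no longer positive where
  the larger of \<bar>s * \<alpha>\<bar>, \<bar>s * \<beta>\<bar> reaches 1; the intermediate value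
  theorem finds a zero before the ray leaves the square of possible cosines. The vertical ray never
  leaves it and is treated apart.\<close>

lemma pillow_radius:
  fixes \<alpha> \<beta> t :: real
  assumes "\<alpha> \<noteq> 0 \<or> \<beta> \<noteq> 0 \<or> t \<noteq> 0"
  obtains s where "0 < s" "\<bar>s * \<alpha>\<bar> \<le> 1" "\<bar>s * \<beta>\<bar> \<le> 1"
    "(s * t)\<^sup>2 = (1 - (s * \<alpha>)\<^sup>2) * (1 - (s * \<beta>)\<^sup>2)"
proof (cases "\<alpha> = 0 \<and> \<beta> = 0")
  case True
  then show ?thesis
    using assms that[of "1 / \<bar>t\<bar>"] by (simp add: power_divide)
next
  case False
  define M where "M = max \<bar>\<alpha>\<bar> \<bar>\<beta>\<bar>"
  have M: "0 < M" "\<bar>\<alpha>\<bar> \<le> M" "\<bar>\<beta>\<bar> \<le> M" "M = \<bar>\<alpha>\<bar> \<or> M = \<bar>\<beta>\<bar>"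
    using False by (auto simp: M_def)
  define g where "g s = (1 - (s * \<alpha>)\<^sup>2) * (1 - (s * \<beta>)\<^sup>2) - (s * t)\<^sup>2" for s
  have "\<exists>s. 0 \<le> s \<and> s \<le> 1 / M \<and> g s = 0"
  proof (rule IVT2')
    have "(1 - (1 / M * \<alpha>)\<^sup>2) * (1 - (1 / M * \<beta>)\<^sup>2) = 0"
      using M(1,4) by (auto simp: power_divide power2_eq_square)
    then have "g (1 / M) = - (1 / M * t)\<^sup>2"
      unfolding g_def by linarith
    then show "g (1 / M) \<le> 0"
      by simp
    show "continuous_on {0..1 / M} g"
      unfolding g_def by (intro continuous_intros)
  qed (use M in \<open>auto simp: g_def\<close>)
  then obtain s where s: "0 \<le> s" "s \<le> 1 / M" "g s = 0"
    by blast
  have "s \<noteq> 0"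
    using s(3) by (auto simp: g_def)
  have le: "\<bar>s * x\<bar> \<le> 1" if "\<bar>x\<bar> \<le> M" for x
  proof -
    have "\<bar>s * x\<bar> \<le> 1 / M * M"
      using s that M unfolding abs_mult by (intro mult_mono) auto
    then show ?thesis
      using M by simp
  qed
  show ?thesis
    using that[of s] s \<open>s \<noteq> 0\<close> le M by (auto simp: g_def)
qed

lemma orbit_map_pillow: "orbit_map 1 \<i> 2 (\<lambda>z. sgn (pillow z)) (sphere 0 1)"
proof (rule orbit_map_radial)
  show "continuous_on UNIV pillow"
    unfolding pillow_def Let_def Complex_eq by (intro continuous_intros)
  have expand: "pillow z = 1 *\<^sub>R (Complex (cos (2 * pi * Re z) - cos (2 * pi * Im z))
      (sin (2 * pi * Re z) * sin (2 * pi * Im z)), cos (2 * pi * Re z) + cos (2 * pi * Im z))" for z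
    by (simp add: pillow_def Let_def)
  have sc: "(sin x * sin y)\<^sup>2 = (1 - (cos x)\<^sup>2) * (1 - (cos y)\<^sup>2)" for x y :: real
    by (simp add: power_mult_distrib sin_squared_eq)
  \<comment> \<open>Admitting s = 0 shows at the same time that the origin is not attained.\<close>
  have star: "pillow w \<noteq> s *\<^sub>R pillow z" if s: "0 \<le> s" "s < 1" for s z w
  proof
    assume eq: "pillow w = s *\<^sub>R pillow z"
    define A B where "A = (cos (2 * pi * Re z))\<^sup>2" and "B = (cos (2 * pi * Im z))\<^sup>2"
    have "cos (2 * pi * Re w) = s * cos (2 * pi * Re z)" "cos (2 * pi * Im w) = s * cos (2 * pi * Im z)"
      "sin (2 * pi * Re w) * sin (2 * pi * Im w) = s * (sin (2 * pi * Re z) * sin (2 * pi * Im z))"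
      using eq unfolding expand[of z] scaleR_one pillow_eq_iff by blast+
    then have "(1 - s\<^sup>2 * A) * (1 - s\<^sup>2 * B) = s\<^sup>2 * ((1 - A) * (1 - B))"
      using sc[of "2 * pi * Re w" "2 * pi * Im w"] sc[of "2 * pi * Re z" "2 * pi * Im z"]
      by (simp add: A_def B_def power_mult_distrib)
    \<comment> \<open>The terms linear in A and B cancel, and both remaining factors are
      positive.\<close>
    then have "(1 - s\<^sup>2) * (1 - s\<^sup>2 * (A * B)) = 0"
      by (simp add: algebra_simps)
    moreover have s2: "s\<^sup>2 < 1"
      using s by (simp add: abs_square_less_1)
    moreover have "A * B \<le> 1 * 1"
      unfolding A_def B_def by (intro mult_mono) (auto simp: abs_square_le_1)
    then have "s\<^sup>2 * (A * B) \<le> s\<^sup>2"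
      using mult_left_mono[of "A * B" 1 "s\<^sup>2"] by simp
    ultimately show False
      by auto
  qed
  show "pillow z \<noteq> 0" for z
    using star[of 0 z z] by simp
  show "pillow w \<noteq> s *\<^sub>R pillow z" if "0 < s" "s < 1" for s z w
    using star that by simp
  show "\<exists>s>0. \<exists>z. pillow z = s *\<^sub>R v" if "v \<noteq> 0" for v
  proof -
    define \<alpha> \<beta> t where "\<alpha> = (snd v + Re (fst v)) / 2" and "\<beta> = (snd v - Re (fst v)) / 2"
      and "t = Im (fst v)"
    have v: "v = (Complex (\<alpha> - \<beta>) t, \<alpha> + \<beta>)"
      by (simp add: \<alpha>_def \<beta>_def t_def prod_eq_iff complex_eq_iff field_simps)
    have "\<alpha> \<noteq> 0 \<or> \<beta> \<noteq> 0 \<or> t \<noteq> 0"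
      using that by (auto simp: v zero_prod_def complex_eq_iff)
    then obtain s where s: "0 < s" "\<bar>s * \<alpha>\<bar> \<le> 1" "\<bar>s * \<beta>\<bar> \<le> 1"
      "(s * t)\<^sup>2 = (1 - (s * \<alpha>)\<^sup>2) * (1 - (s * \<beta>)\<^sup>2)"
      by (rule pillow_radius)
    \<comment> \<open>Values of arccos have nonnegative sine, so the sign of t is put into
      b.\<close>
    define a b where "a = arccos (s * \<alpha>)" and "b = (if 0 \<le> t then 1 else - 1) * arccos (s * \<beta>)"
    have "sqrt (1 - (s * \<alpha>)\<^sup>2) * sqrt (1 - (s * \<beta>)\<^sup>2) = s * \<bar>t\<bar>"
      using s by (metis abs_mult abs_of_pos real_sqrt_abs real_sqrt_mult)
    then have "cos a = s * \<alpha>" "cos b = s * \<beta>" "sin a * sin b = s * t"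
      using s by (auto simp: a_def b_def cos_arccos_abs sin_arccos_abs)
    then have "pillow (Complex (a / (2 * pi)) (b / (2 * pi))) = s *\<^sub>R v"
      unfolding v pillow_eq_iff by simp
    then show ?thesis
      using s by blast
  qed
  show "pillow z = pillow w \<longleftrightarrow>
      (\<exists>\<zeta> l. \<zeta> ^ 2 = 1 \<and> l \<in> torus_lattice 1 \<i> \<and> w = \<zeta> * z + l)" for z w
  proof -
    have "pillow z = pillow w \<longleftrightarrow> w - z \<in> torus_lattice 1 \<i> \<or> w - (- z) \<in> torus_lattice 1 \<i>"
      (is "_ \<longleftrightarrow> ?R")
    proof -
      have Im_i: "Im \<i> \<noteq> 0"
        by simp
      let ?a = "2 * pi * Re z" and ?b = "2 * pi * Im z" and ?c = "2 * pi * Re w" and ?d = "2 * pi * Im w"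
      have "pillow w = pillow z \<longleftrightarrow> cos ?c = cos ?a \<and> cos ?d = cos ?b \<and> sin ?c * sin ?d = sin ?a * sin ?b"
        using pillow_eq_iff[of w 1] expand[of z] by simp
      \<comment> \<open>The cosines determine both angles up to sign. The product of the sines
        excludes opposite sign choices unless a sine vanishes, and then its sign is
        immaterial.\<close>
      also have "\<dots> \<longleftrightarrow> (cos ?c = cos ?a \<and> sin ?c = sin ?a \<and> cos ?d = cos ?b \<and> sin ?d = sin ?b) \<or>
          (cos ?c = cos ?a \<and> sin ?c = - sin ?a \<and> cos ?d = cos ?b \<and> sin ?d = - sin ?b)"
      proof -
        have "(sin ?c)\<^sup>2 = (sin ?a)\<^sup>2" if "cos ?c = cos ?a"
          using that by (simp add: sin_squared_eq)
        moreover have "(sin ?d)\<^sup>2 = (sin ?b)\<^sup>2" if "cos ?d = cos ?b"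
          using that by (simp add: sin_squared_eq)
        ultimately show ?thesis
          unfolding power2_eq_iff by auto
      qed
      also have "\<dots> \<longleftrightarrow> ?R"
        unfolding lattice_cis_iff[OF Im_i]
        by (simp add: coord1_def coord2_def complex_eq_iff conj_ac)
      finally show ?thesis
        by auto
    qed
    also have "\<dots> \<longleftrightarrow> (\<exists>\<zeta> l. \<zeta> ^ 2 = 1 \<and> l \<in> torus_lattice 1 \<i> \<and> w = \<zeta> * z + l)"
    proof
      assume "w - z \<in> torus_lattice 1 \<i> \<or> w - (- z) \<in> torus_lattice 1 \<i>"
      then show "\<exists>\<zeta> l. \<zeta> ^ 2 = 1 \<and> l \<in> torus_lattice 1 \<i> \<and> w = \<zeta> * z + l"
      proof
        assume "w - z \<in> torus_lattice 1 \<i>"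
        then show ?thesis
          by (intro exI[of _ 1] exI[of _ "w - z"]) simp
      next
        assume "w - (- z) \<in> torus_lattice 1 \<i>"
        then show ?thesis
          by (intro exI[of _ "- 1"] exI[of _ "w - (- z)"]) simp
      qed
    qed (auto simp: power2_eq_1_iff)
    finally show ?thesis .
  qed
qed auto

lemma pillow_rotate: "pillow (\<i> * z) = (- fst (pillow z), snd (pillow z))"
  by (simp add: pillow_def Let_def complex_eq_iff)

lemma sgn_half_turn: "sgn (- w, t) = (- fst (sgn (w, t)), snd (sgn (w, t)))"
  for w :: complex and t :: real
  by (simp add: sgn_div_norm norm_Pair)

lemma orbit_map_square: "orbit_map 1 \<i> 4 (\<lambda>z. angle_double (sgn (pillow z))) (sphere 0 1)"
  using orbit_map_angle_double[OF orbit_map_pillow, of \<i>]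
  by (simp add: pillow_rotate sgn_half_turn)

section \<open>Unit triples of product 1 and their cubic\<close>

definition vandermonde3 :: "complex \<Rightarrow> complex \<Rightarrow> complex \<Rightarrow> complex" where
  "vandermonde3 a b c = (a - b) * (b - c) * (c - a)"

text \<open>Minus the discriminant of
  \<open>X ^ 3 - \<sigma> * X\<^sup>2 + cnj \<sigma> * X - 1\<close>, the cubic of a unit triple
  with product 1 and sum \<sigma>.\<close>

definition cubic_disc :: "complex \<Rightarrow> real" where
  "cubic_disc \<sigma> = 27 - 18 * (cmod \<sigma>)\<^sup>2 + 8 * Re (\<sigma> ^ 3) - (cmod \<sigma>) ^ 4"

text \<open>The discriminant in terms of the elementary symmetric functions. The hypotheses speak of
  these functions alone, since the lemma is also applied to roots whose moduli are still
  unknown.\<close>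

lemma vandermonde3_square:
  assumes "a * b * c = 1" "a * b + b * c + c * a = cnj \<sigma>" "a + b + c = \<sigma>"
  shows "(vandermonde3 a b c)\<^sup>2 = - of_real (cubic_disc \<sigma>)"
proof -
  define s p where "s = a + b + c" and "p = a * b + b * c + c * a"
  have "(vandermonde3 a b c)\<^sup>2 =
      s\<^sup>2 * p\<^sup>2 - 4 * p ^ 3 - 4 * s ^ 3 * (a * b * c) + 18 * s * p * (a * b * c) - 27 * (a * b * c)\<^sup>2"
    unfolding vandermonde3_def s_def p_def by algebra
  also have "\<dots> = \<sigma>\<^sup>2 * (cnj \<sigma>)\<^sup>2 - 4 * (cnj \<sigma>) ^ 3 - 4 * \<sigma> ^ 3 + 18 * \<sigma> * cnj \<sigma> - 27"
    using assms by (simp add: s_def p_def)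
  also have "\<dots> = (\<sigma> * cnj \<sigma>)\<^sup>2 - 4 * (\<sigma> ^ 3 + cnj (\<sigma> ^ 3)) + 18 * (\<sigma> * cnj \<sigma>) - 27"
    by (simp add: power_mult_distrib algebra_simps)
  also have "\<dots> = - of_real (cubic_disc \<sigma>)"
    unfolding complex_add_cnj complex_norm_square[symmetric] by (simp add: cubic_disc_def)
  finally show ?thesis .
qed

lemma cnj_unit_eq:
  assumes "cmod x = 1" "x * y = 1"
  shows "cnj x = y"
proof -
  have "x * cnj x = 1"
    using assms(1) by (simp add: complex_norm_square[symmetric])
  then have "cnj x = cnj x * (x * y)"
    using assms(2) by simp
  also have "\<dots> = (x * cnj x) * y"
    by (simp only: mult_ac)
  finally show ?thesis
    using \<open>x * cnj x = 1\<close> by simp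
qed

text \<open>Conjugation inverts a unit number, hence sends each entry to the product of the other
  two. It thus maps the first symmetric function to the second and negates the Vandermonde
  determinant, which is therefore imaginary.\<close>

lemma unit_triple:
  assumes "cmod a = 1" "cmod b = 1" "cmod c = 1" "a * b * c = 1"
  shows "a * b + b * c + c * a = cnj (a + b + c)" "Re (vandermonde3 a b c) = 0"
    "(Im (vandermonde3 a b c))\<^sup>2 = cubic_disc (a + b + c)"
proof -
  have abc: "cnj a = b * c" "cnj b = c * a" "cnj c = a * b"
    using assms by (intro cnj_unit_eq; simp add: mult_ac)+
  then show p: "a * b + b * c + c * a = cnj (a + b + c)"
    by simp
  have "cnj (vandermonde3 a b c) = - (a * b * c) * vandermonde3 a b c"
    by (simp add: vandermonde3_def abc algebra_simps)
  then have cnj: "cnj (vandermonde3 a b c) = - vandermonde3 a b c"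
    using assms by simp
  from arg_cong[OF cnj, of Re] show re: "Re (vandermonde3 a b c) = 0"
    by simp
  have "(vandermonde3 a b c)\<^sup>2 = - of_real (cubic_disc (a + b + c))"
    using assms p by (intro vandermonde3_square) auto
  from arg_cong[OF this, of Re] show "(Im (vandermonde3 a b c))\<^sup>2 = cubic_disc (a + b + c)"
    using re by (simp add: power2_eq_square)
qed

lemma Re_cube_le: "\<bar>Re (\<sigma> ^ 3)\<bar> \<le> (cmod \<sigma>) ^ 3"
  using abs_Re_le_cmod[of "\<sigma> ^ 3"] by (simp add: norm_power)

lemma cubic_disc_scale:
  assumes "0 \<le> s"
  shows "cubic_disc (of_real s * \<sigma>) =
    27 - 18 * s\<^sup>2 * (cmod \<sigma>)\<^sup>2 + 8 * s ^ 3 * Re (\<sigma> ^ 3) - s ^ 4 * (cmod \<sigma>) ^ 4"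
proof -
  have "Re ((of_real s * \<sigma>) ^ 3) = s ^ 3 * Re (\<sigma> ^ 3)"
    by (simp add: power_mult_distrib flip: of_real_power)
  then show ?thesis
    using assms by (simp add: cubic_disc_def norm_mult power_mult_distrib)
qed

text \<open>Replacing \<open>Re (\<sigma> ^ 3)\<close> by its bound r ^ 3 leaves (1 - s) r ^ 2 times
  a quadratic in r, positive because its discriminant \<open>B\<^sup>2 - 72 * (1 + s) * A\<close> is
  negative.\<close>

lemma cubic_disc_decreasing:
  assumes s: "0 \<le> s" "s < 1" and \<sigma>: "\<sigma> \<noteq> 0"
  shows "cubic_disc \<sigma> < cubic_disc (of_real s * \<sigma>)"
proof -
  define r where "r = cmod \<sigma>"
  have r: "0 < r"
    using \<sigma> by (simp add: r_def)
  define A B where "A = (1 + s) * (1 + s\<^sup>2)" and "B = 8 * (1 + s + s\<^sup>2)"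
  have A: "0 < A"
    using s by (auto simp: A_def intro!: mult_pos_pos add_pos_nonneg)
  have "72 * (1 + s) * A - B\<^sup>2 = 8 * (1 - s)\<^sup>2 * (1 + s\<^sup>2 + 4 * s)"
    by (simp add: A_def B_def power2_eq_square algebra_simps)
  also have "\<dots> > 0"
    using s by (intro mult_pos_pos) (auto intro!: add_pos_nonneg)
  finally have "0 < (2 * A * r - B)\<^sup>2 + (72 * (1 + s) * A - B\<^sup>2)"
    by (simp add: add_nonneg_pos)
  also have "\<dots> = 4 * A * (A * r\<^sup>2 - B * r + 18 * (1 + s))"
    by (simp add: power2_eq_square algebra_simps)
  finally have "0 < A * r\<^sup>2 - B * r + 18 * (1 + s)"
    using A by (simp add: zero_less_mult_iff)
  then have "0 < (1 - s) * r\<^sup>2 * (A * r\<^sup>2 - B * r + 18 * (1 + s))"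
    using s r by (intro mult_pos_pos) auto
  also have "\<dots> = 18 * (1 - s\<^sup>2) * r\<^sup>2 - 8 * (1 - s ^ 3) * r ^ 3 + (1 - s ^ 4) * r ^ 4"
    by (simp add: A_def B_def power2_eq_square power3_eq_cube power4_eq_xxxx algebra_simps)
  also have "\<dots> \<le> 18 * (1 - s\<^sup>2) * r\<^sup>2 - 8 * (1 - s ^ 3) * Re (\<sigma> ^ 3) + (1 - s ^ 4) * r ^ 4"
  proof -
    have "s ^ 3 \<le> 1"
      using s by (simp add: power_le_one)
    then have "(1 - s ^ 3) * Re (\<sigma> ^ 3) \<le> (1 - s ^ 3) * r ^ 3"
      using Re_cube_le[of \<sigma>] by (intro mult_left_mono) (auto simp: r_def)
    then show ?thesis
      unfolding mult.assoc by linarith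
  qed
  also have "\<dots> = cubic_disc (of_real s * \<sigma>) - cubic_disc \<sigma>"
    unfolding cubic_disc_scale[OF s(1)] cubic_disc_def[of \<sigma>] by (simp add: algebra_simps flip: r_def)
  finally show ?thesis by simp
qed

lemma cubic_disc_radius:
  assumes "\<sigma> \<noteq> 0 \<or> t \<noteq> 0"
  obtains s where "0 < s" "(s * t)\<^sup>2 = cubic_disc (of_real s * \<sigma>)"
proof (cases "\<sigma> = 0")
  case True
  then show ?thesis
    using assms that[of "sqrt 27 / \<bar>t\<bar>"] by (simp add: cubic_disc_def power_divide power_mult_distrib)
next
  case False
  define r where "r = cmod \<sigma>"
  have r: "0 < r"
    using False by (simp add: r_def)
  define g where "g s = 27 - 18 * s\<^sup>2 * r\<^sup>2 + 8 * s ^ 3 * Re (\<sigma> ^ 3) - s ^ 4 * r ^ 4 - (s * t)\<^sup>2" for s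
  \<comment> \<open>At 3 / r the modulus is 3, the maximum for a sum of three unit numbers; there
    \<open>cubic_disc\<close> is at most 27 - 162 + 216 - 81 = 0.\<close>
  have "\<exists>s. 0 \<le> s \<and> s \<le> 3 / r \<and> g s = 0"
  proof (rule IVT2')
    have "8 * (3 / r) ^ 3 * Re (\<sigma> ^ 3) \<le> 8 * (3 / r) ^ 3 * r ^ 3"
      using Re_cube_le[of \<sigma>] r by (intro mult_left_mono) (auto simp: r_def)
    also have "\<dots> = 216"
      using r by (simp add: power_divide)
    finally have "8 * (3 / r) ^ 3 * Re (\<sigma> ^ 3) \<le> 216" .
    moreover have "18 * (3 / r)\<^sup>2 * r\<^sup>2 = 162" "(3 / r) ^ 4 * r ^ 4 = 81"
      using r by (simp_all add: power_divide)
    ultimately show "g (3 / r) \<le> 0"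
      using zero_le_power2[of "3 / r * t"] unfolding g_def by linarith
    show "continuous_on {0..3 / r} g"
      unfolding g_def by (intro continuous_intros)
  qed (use r in \<open>auto simp: g_def\<close>)
  then obtain s where s: "0 \<le> s" "g s = 0"
    by blast
  moreover have "s \<noteq> 0"
    using s(2) by (auto simp: g_def)
  ultimately show ?thesis
    using that[of s] by (simp add: cubic_disc_scale g_def r_def)
qed

text \<open>A self-inversive cubic has its roots either on the unit circle or at \<open>a\<close>, \<open>1 / cnj a\<close>,
  \<open>cnj a / a\<close>; in the second case its discriminant is positive.\<close>

lemma vandermonde3_inversive_pair:
  assumes "a \<noteq> 0" "cmod a \<noteq> 1" "b = 1 / cnj a" "a * b * c = 1"
  obtains D where "D \<noteq> 0" "vandermonde3 a b c = of_real D"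
proof
  let ?N = "(cmod a)\<^sup>2"
  let ?D = "(?N - 1) / ?N\<^sup>2 * (cmod (a - (cnj a)\<^sup>2))\<^sup>2"
  have c: "c = cnj a / a"
  proof -
    have "b * cnj a = 1"
      using assms by simp
    then have "cnj a = (a * b * c) * cnj a"
      using assms(4) by simp
    also have "\<dots> = a * c * (b * cnj a)"
      by (simp only: mult_ac)
    finally show ?thesis
      using assms(1) \<open>b * cnj a = 1\<close> by (simp add: field_simps)
  qed
  \<comment> \<open>The numerators of b - c and c - a are conjugate to each other, so their product
    is a squared modulus.\<close>
  have "vandermonde3 a b c = (a * cnj a - 1) / (a * cnj a)\<^sup>2 * ((a - (cnj a)\<^sup>2) * cnj (a - (cnj a)\<^sup>2))"
    using assms(1) by (simp add: vandermonde3_def assms(3) c field_simps power2_eq_square)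
  also have "\<dots> = of_real ?D"
    unfolding complex_norm_square[symmetric] by simp
  finally show "vandermonde3 a b c = of_real ?D" .
  have "a \<noteq> (cnj a)\<^sup>2"
  proof
    assume "a = (cnj a)\<^sup>2"
    then have "cmod a = (cmod a)\<^sup>2"
      by (metis complex_mod_cnj norm_power)
    then show False
      using assms(1,2) by (simp add: power2_eq_square)
  qed
  moreover have "cmod a \<noteq> - 1"
    using norm_ge_zero[of a] by linarith
  then have "?N \<noteq> 1"
    using assms(2) by (simp add: power2_eq_1_iff)
  ultimately show "?D \<noteq> 0"
    using assms(1) by simp
qed

text \<open>A root off the circle brings its inverse conjugate as a second root; the Vandermonde
  determinant is then real and nonzero, so \<open>cubic_disc\<close> would be negative.\<close>

lemma root_on_unit_circle:
  assumes abc: "a * b * c = 1" and p: "a * b + b * c + c * a = cnj (a + b + c)"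
    and disc: "0 \<le> cubic_disc (a + b + c)"
  shows "cmod a = 1"
proof (rule ccontr)
  assume a1: "cmod a \<noteq> 1"
  define \<sigma> where "\<sigma> = a + b + c"
  have a0: "a \<noteq> 0"
    using abc by auto
  define w where "w = 1 / cnj a"
  have fact: "(x - a) * (x - b) * (x - c) = x ^ 3 - \<sigma> * x\<^sup>2 + cnj \<sigma> * x - 1" for x
    using abc p unfolding \<sigma>_def by algebra
  \<comment> \<open>Conjugating the equation of a and multiplying by w ^ 3 gives, up to sign, the
    same equation for w.\<close>
  have "cnj (a ^ 3 - \<sigma> * a\<^sup>2 + cnj \<sigma> * a - 1) = 0"
    using fact[of a] by simp
  then have "(cnj a) ^ 3 - cnj \<sigma> * (cnj a)\<^sup>2 + \<sigma> * cnj a - 1 = 0"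
    by simp
  moreover have "w * cnj a = 1"
    using a0 by (simp add: w_def)
  ultimately have "w ^ 3 - \<sigma> * w\<^sup>2 + cnj \<sigma> * w - 1 = 0"
    by algebra
  then have "(w - a) * (w - b) * (w - c) = 0"
    using fact by simp
  moreover have "w \<noteq> a"
  proof
    assume "w = a"
    then have "a * cnj a = 1"
      using a0 by (simp add: w_def field_simps)
    then have "(cmod a)\<^sup>2 = 1"
      by (metis complex_norm_square of_real_eq_1_iff of_real_power)
    then show False
      using a1 norm_ge_zero[of a] by (auto simp: power2_eq_1_iff)
  qed
  ultimately consider "b = w" | "c = w"
    by auto
  then obtain D where D: "D \<noteq> 0" "(vandermonde3 a b c)\<^sup>2 = of_real (D\<^sup>2)"
  proof cases
    case 1
    then obtain D where "D \<noteq> 0" "vandermonde3 a b c = of_real D"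
      using vandermonde3_inversive_pair[OF a0 a1 _ abc] w_def by blast
    then show ?thesis
      using that by simp
  next
    case 2
    have "a * c * b = 1"
      using abc by (simp add: mult_ac)
    with 2 obtain D where "D \<noteq> 0" "vandermonde3 a c b = of_real D"
      using vandermonde3_inversive_pair[OF a0 a1] w_def by blast
    moreover have "(vandermonde3 a b c)\<^sup>2 = (vandermonde3 a c b)\<^sup>2"
      by (simp add: vandermonde3_def power2_eq_square algebra_simps)
    ultimately show ?thesis
      using that by simp
  qed
  have "complex_of_real (D\<^sup>2) = - of_real (cubic_disc (a + b + c))"
    using vandermonde3_square[OF abc p refl] D by simp
  then have "D\<^sup>2 = - cubic_disc (a + b + c)"
    by (metis of_real_eq_iff of_real_minus)
  then show False
    using disc D(1) by (metis neg_le_0_iff_le power2_eq_iff_nonneg power_zero_numeral zero_le_power2 order_antisym zero_eq_power2)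
qed

text \<open>One root comes from the fundamental theorem of algebra, the others from the quadratic
  formula; if the Vandermonde determinant has the wrong sign, two roots are exchanged.\<close>

lemma unit_triple_exists:
  assumes t: "t\<^sup>2 = cubic_disc \<sigma>"
  obtains a b c where "cmod a = 1" "cmod b = 1" "cmod c = 1" "a * b * c = 1" "a + b + c = \<sigma>"
    "Im (vandermonde3 a b c) = t"
proof -
  define p where "p i = (if i = 0 then - 1 else if i = 1 then cnj \<sigma> else if i = 2 then - \<sigma> else 1)" for i :: nat
  have "p 0 = 0 \<or> (\<exists>i\<in>{1..3}. p i \<noteq> 0)"
    by (rule disjI2, rule bexI[of _ 3]) (auto simp: p_def)
  then obtain a where "(\<Sum>i\<le>3. p i * a ^ i) = 0"
    using fundamental_theorem_of_algebra by blast
  then have a: "a ^ 3 - \<sigma> * a\<^sup>2 + cnj \<sigma> * a - 1 = 0"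
    by (simp add: p_def numeral_eq_Suc One_nat_def algebra_simps)
  then have a0: "a \<noteq> 0"
    by auto
  \<comment> \<open>b and c are to be the roots of
    \<open>X\<^sup>2 - (\<sigma> - a) * X + 1 / a\<close>.\<close>
  define q where "q = csqrt ((\<sigma> - a)\<^sup>2 - 4 / a)"
  define b c where "b = (\<sigma> - a + q) / 2" and "c = (\<sigma> - a - q) / 2"
  have sum: "a + b + c = \<sigma>"
    by (simp add: b_def c_def field_simps)
  have "4 * (b * c) = (\<sigma> - a)\<^sup>2 - q\<^sup>2"
  proof -
    have "2 * b = \<sigma> - a + q" "2 * c = \<sigma> - a - q"
      by (simp_all add: b_def c_def)
    then show ?thesis
      by algebra
  qed
  also have "\<dots> = 4 / a"
    by (simp add: q_def)
  finally have abc: "a * b * c = 1"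
    using a0 by (simp add: field_simps)
  have "a * (a * b + b * c + c * a) = a * cnj \<sigma>"
    using a abc sum by algebra
  then have p: "a * b + b * c + c * a = cnj (a + b + c)"
    using a0 sum by simp
  have disc: "0 \<le> cubic_disc (a + b + c)"
    using t sum by (metis zero_le_power2)
  have unit: "cmod a = 1" "cmod b = 1" "cmod c = 1"
    using root_on_unit_circle[of a b c] root_on_unit_circle[of b c a] root_on_unit_circle[of c a b]
      abc p disc by (simp_all add: ac_simps)
  have "(Im (vandermonde3 a b c))\<^sup>2 = t\<^sup>2"
    using unit_triple(3)[OF unit abc] t sum by simp
  then consider "Im (vandermonde3 a b c) = t" | "Im (vandermonde3 a b c) = - t"
    by (auto simp: power2_eq_iff)
  then show ?thesis
  proof cases
    case 1
    then show ?thesis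
      using that unit abc sum by blast
  next
    case 2
    have "vandermonde3 a c b = - vandermonde3 a b c"
      by (simp add: vandermonde3_def algebra_simps)
    then show ?thesis
      using that[of a c b] unit abc sum 2 by (simp add: ac_simps)
  qed
qed

text \<open>Equal sums give, by conjugation, equal cubics, so the triples agree up to permutation.
  Odd permutations change the sign of the Vandermonde determinant; if it vanishes, two entries
  coincide and an odd permutation acts like a cyclic one.\<close>

lemma unit_triple_eq_iff:
  assumes u: "cmod a = 1" "cmod b = 1" "cmod c = 1" "a * b * c = 1"
    and u': "cmod a' = 1" "cmod b' = 1" "cmod c' = 1" "a' * b' * c' = 1"
  shows "a' + b' + c' = a + b + c \<and> Im (vandermonde3 a' b' c') = Im (vandermonde3 a b c) \<longleftrightarrow>
    (a' = a \<and> b' = b \<and> c' = c) \<or> (a' = b \<and> b' = c \<and> c' = a) \<or> (a' = c \<and> b' = a \<and> c' = b)"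
    (is "?L \<longleftrightarrow> ?R")
proof -
  have rotate: "vandermonde3 a b c = vandermonde3 b c a" "vandermonde3 a b c = vandermonde3 c a b"
    by (simp_all add: vandermonde3_def)
  show ?thesis
  proof
    assume L: ?L
    then have V: "vandermonde3 a' b' c' = vandermonde3 a b c"
      using unit_triple(2)[OF u] unit_triple(2)[OF u'] by (simp add: complex_eq_iff)
    have sum: "a' + b' + c' = a + b + c"
      using L by blast
    have p: "a' * b' + b' * c' + c' * a' = a * b + b * c + c * a"
      using unit_triple(1)[OF u] unit_triple(1)[OF u'] L by simp
    \<comment> \<open>Both sides are values at a' of the same cubic, factored in two ways.\<close>
    have "(a' - a) * (a' - b) * (a' - c) = (a' - a') * (a' - b') * (a' - c')"
      using sum p u(4) u'(4) by algebra
    then have root: "a' = a \<or> a' = b \<or> a' = c"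
      by auto
    have key: "(y' = y \<and> z' = z) \<or> (y' = z \<and> z' = y \<and> (x = y \<or> y = z \<or> z = x))"
      if "y' + z' = y + z" "x * y' * z' = x * y * z" "x \<noteq> 0"
        "vandermonde3 x y' z' = vandermonde3 x y z" for x y z y' z'
    proof -
      have "(y' - y) * (y' - z) = 0"
        using that by algebra
      then consider "y' = y" | "y' = z" "y' \<noteq> y"
        by auto
      then show ?thesis
      proof cases
        case 2
        then have "z' = y"
          using that(1) by simp
        then have "vandermonde3 x z y = vandermonde3 x y z"
          using that(4) 2 by simp
        moreover have "vandermonde3 x z y = - vandermonde3 x y z"
          by (simp add: vandermonde3_def algebra_simps)
        ultimately have "vandermonde3 x y z = 0"
          by simp
        then show ?thesis
          using 2 \<open>z' = y\<close> by (auto simp: vandermonde3_def)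
      qed (use that(1) in auto)
    qed
    have nz: "a \<noteq> 0" "b \<noteq> 0" "c \<noteq> 0"
      using u by auto
    from root show ?R
    proof (elim disjE)
      assume a': "a' = a"
      have "b' + c' = b + c" "a * b' * c' = a * b * c"
        using sum u(4) u'(4) a' by auto
      from key[OF this nz(1)] V show ?R
        by (auto simp: a')
    next
      assume a': "a' = b"
      have "b' + c' = c + a" "b * b' * c' = b * c * a"
        using sum u(4) u'(4) a' by (auto simp: algebra_simps)
      from key[OF this nz(2)] V show ?R
        by (auto simp: a' rotate(1))
    next
      assume a': "a' = c"
      have "b' + c' = a + b" "c * b' * c' = c * a * b"
        using sum u(4) u'(4) a' by (auto simp: algebra_simps)
      from key[OF this nz(3)] V show ?R
        by (auto simp: a' rotate(2))
    qed
  next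
    assume ?R
    then show ?L
      using rotate by (auto simp: ac_simps)
  qed
qed

section \<open>The hexagonal lattice and its three characters\<close>

definition omega :: complex where
  "omega = Complex (- 1 / 2) (sqrt 3 / 2)"

lemma omega_square: "omega\<^sup>2 = - 1 - omega"
  by (simp add: omega_def power2_eq_square complex_eq_iff)

lemma Im_omega [simp]: "Im omega \<noteq> 0"
  by (simp add: omega_def)

lemma omega_cube: "omega ^ 3 = 1"
  using omega_square by algebra

lemma cube_root_unity_iff: "z ^ 3 = 1 \<longleftrightarrow> z = 1 \<or> z = omega \<or> z = omega\<^sup>2"
proof -
  have "z ^ 3 - 1 = (z - 1) * (z - omega) * (z - omega\<^sup>2)"
    using omega_square by algebra
  then show ?thesis
    by auto
qed

lemma coords_omega_mult:
  "coord1 omega (omega * z) = - coord2 omega z"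
  "coord2 omega (omega * z) = coord1 omega z - coord2 omega z"
proof -
  define x y where "x = coord1 omega z" and "y = coord2 omega z"
  have "omega * z = omega * (of_real x + of_real y * omega)"
    using coords_expand[of omega z] by (simp add: x_def y_def)
  also have "\<dots> = of_real (- y) + of_real (x - y) * omega"
  proof -
    have "omega * (X + Y * omega) = - Y + (X - Y) * omega" for X Y
      using omega_square by algebra
    then show ?thesis by simp
  qed
  finally have "omega * z = of_real (- y) + of_real (x - y) * omega" .
  then show "coord1 omega (omega * z) = - coord2 omega z"
    "coord2 omega (omega * z) = coord1 omega z - coord2 omega z"
    using coords_of_real[of omega "- y" "x - y"] by (simp_all add: x_def y_def del: of_real_diff of_real_minus)
qed

text \<open>The angles of \<open>hex1\<close>, \<open>hex2\<close>, \<open>hex3\<close> are the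
  first coordinates of z, omega z and \<open>omega\<^sup>2 * z\<close>, so multiplication by omega
  permutes the three characters cyclically.\<close>

definition hex1 :: "complex \<Rightarrow> complex" where
  "hex1 z = cis (2 * pi * coord1 omega z)"

definition hex2 :: "complex \<Rightarrow> complex" where
  "hex2 z = cis (- (2 * pi * coord2 omega z))"

definition hex3 :: "complex \<Rightarrow> complex" where
  "hex3 z = cis (2 * pi * (coord2 omega z - coord1 omega z))"

lemma hex_omega: "hex1 (omega * z) = hex2 z" "hex2 (omega * z) = hex3 z" "hex3 (omega * z) = hex1 z"
  by (simp_all add: hex1_def hex2_def hex3_def coords_omega_mult algebra_simps)

lemma cnj_cis: "cnj (cis x) = cis (- x)"
  by (simp add: cis_cnj)

lemma hex_unit:
  "cmod (hex1 z) = 1" "cmod (hex2 z) = 1" "cmod (hex3 z) = 1" "hex1 z * hex2 z * hex3 z = 1"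
  by (simp_all add: hex1_def hex2_def hex3_def cis_mult algebra_simps)

lemma hex_minus: "hex1 (- z) = cnj (hex1 z)" "hex2 (- z) = cnj (hex2 z)" "hex3 (- z) = cnj (hex3 z)"
  by (simp_all add: hex1_def hex2_def hex3_def cnj_cis coord1_def coord2_def algebra_simps)

lemma hex3_eq: "hex3 z = cnj (hex1 z * hex2 z)"
  by (simp add: hex1_def hex2_def hex3_def cnj_cis cis_mult algebra_simps)

lemma lattice_hex_iff:
  "w - z \<in> torus_lattice 1 omega \<longleftrightarrow> hex1 w = hex1 z \<and> hex2 w = hex2 z \<and> hex3 w = hex3 z"
proof -
  have "hex2 w = hex2 z \<longleftrightarrow> cis (2 * pi * coord2 omega w) = cis (2 * pi * coord2 omega z)"
    unfolding hex2_def cnj_cis[symmetric] by simp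
  then show ?thesis
    unfolding lattice_cis_iff[OF Im_omega] by (auto simp: hex3_eq hex1_def)
qed

text \<open>Negating z conjugates the triple, hence both its sum and its Vandermonde determinant.
  Collecting the two imaginary parts in the complex component makes this the half turn.\<close>

definition hexmap :: "complex \<Rightarrow> complex \<times> real" where
  "hexmap z = (let \<sigma> = hex1 z + hex2 z + hex3 z in
     (Complex (Im \<sigma>) (Im (vandermonde3 (hex1 z) (hex2 z) (hex3 z))), Re \<sigma>))"

lemma hexmap_eq_iff:
  "hexmap z = s *\<^sub>R (Complex (Im \<sigma>) t, Re \<sigma>) \<longleftrightarrow>
     hex1 z + hex2 z + hex3 z = of_real s * \<sigma> \<and>
     Im (vandermonde3 (hex1 z) (hex2 z) (hex3 z)) = s * t"
  by (auto simp: hexmap_def Let_def complex_eq_iff)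

lemma hexmap_expand:
  "hexmap z = 1 *\<^sub>R (Complex (Im (hex1 z + hex2 z + hex3 z))
     (Im (vandermonde3 (hex1 z) (hex2 z) (hex3 z))), Re (hex1 z + hex2 z + hex3 z))"
  by (simp add: hexmap_def Let_def)

lemma orbit_map_hexmap: "orbit_map 1 omega 3 (\<lambda>z. sgn (hexmap z)) (sphere 0 1)"
proof (rule orbit_map_radial)
  show "continuous_on UNIV hexmap"
    unfolding hexmap_def Let_def Complex_eq hex1_def hex2_def hex3_def vandermonde3_def
    by (intro continuous_intros)
  have star: "hexmap w \<noteq> s *\<^sub>R hexmap z" if s: "0 \<le> s" "s < 1" for s z w
  proof
    assume eq: "hexmap w = s *\<^sub>R hexmap z"
    define \<sigma> t where "\<sigma> = hex1 z + hex2 z + hex3 z"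
      and "t = Im (vandermonde3 (hex1 z) (hex2 z) (hex3 z))"
    have "hexmap z = (Complex (Im \<sigma>) t, Re \<sigma>)"
      by (simp add: hexmap_def Let_def \<sigma>_def t_def)
    with eq have w: "hex1 w + hex2 w + hex3 w = of_real s * \<sigma>"
      "Im (vandermonde3 (hex1 w) (hex2 w) (hex3 w)) = s * t"
      using hexmap_eq_iff by metis+
    have t: "t\<^sup>2 = cubic_disc \<sigma>"
      unfolding t_def \<sigma>_def by (rule unit_triple(3)[OF hex_unit])
    have "(s * t)\<^sup>2 = cubic_disc (of_real s * \<sigma>)"
      using unit_triple(3)[OF hex_unit, of w] w by simp
    then have eq2: "s\<^sup>2 * cubic_disc \<sigma> = cubic_disc (of_real s * \<sigma>)"
      using t by (simp add: power_mult_distrib)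
    have s2: "s\<^sup>2 < 1"
      using s by (simp add: abs_square_less_1)
    have "s\<^sup>2 * cubic_disc \<sigma> \<le> 1 * cubic_disc \<sigma>"
      using s2 t by (intro mult_right_mono) (auto simp flip: t)
    \<comment> \<open>Shrinking multiplies the squared height by \<open>s\<^sup>2\<close>, which
      does not increase it, whereas \<open>cubic_disc\<close> grows; for \<sigma> = 0 it stays at 27
      while the squared height drops.\<close>
    then show False
      using cubic_disc_decreasing[OF s, of \<sigma>] eq2 s2 by (cases "\<sigma> = 0") (auto simp: cubic_disc_def)
  qed
  show "hexmap z \<noteq> 0" for z
    using star[of 0 z z] by simp
  show "hexmap w \<noteq> s *\<^sub>R hexmap z" if "0 < s" "s < 1" for s z w
    using star that by simp
  show "\<exists>s>0. \<exists>z. hexmap z = s *\<^sub>R v" if "v \<noteq> 0" for v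
  proof -
    define \<sigma> t where "\<sigma> = Complex (snd v) (Re (fst v))" and "t = Im (fst v)"
    have v: "v = (Complex (Im \<sigma>) t, Re \<sigma>)"
      by (simp add: \<sigma>_def t_def prod_eq_iff)
    have "\<sigma> \<noteq> 0 \<or> t \<noteq> 0"
      using that by (auto simp: v zero_prod_def complex_eq_iff)
    then obtain s where s: "0 < s" "(s * t)\<^sup>2 = cubic_disc (of_real s * \<sigma>)"
      by (rule cubic_disc_radius)
    obtain a b c where abc: "cmod a = 1" "cmod b = 1" "cmod c = 1" "a * b * c = 1"
      "a + b + c = of_real s * \<sigma>" "Im (vandermonde3 a b c) = s * t"
      using unit_triple_exists[OF s(2)] by blast
    obtain x where x: "a = cis (2 * pi * x)"
      using unit_complex_cis_2pi abc(1) by blast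
    obtain y where y: "b = cis (2 * pi * y)"
      using unit_complex_cis_2pi abc(2) by blast
    \<comment> \<open>\<open>hex2\<close> carries a minus sign, hence the coordinate - y. The third
      entry is then forced by the product 1.\<close>
    define z where "z = of_real x + of_real (- y) * omega"
    have "coord1 omega z = x" "coord2 omega z = - y"
      unfolding z_def by (rule coords_of_real[OF Im_omega])+
    then have ab: "hex1 z = a" "hex2 z = b"
      by (simp_all add: hex1_def hex2_def x y)
    moreover have "hex3 z = c"
    proof -
      have "a * b * hex3 z = a * b * c"
        using hex_unit(4)[of z] abc(4) by (simp add: ab)
      moreover have "a * b \<noteq> 0"
        using abc by auto
      ultimately show ?thesis by simp
    qed
    ultimately have "hexmap z = s *\<^sub>R v"
      using abc unfolding v hexmap_eq_iff by simp
    then show ?thesis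
      using s by blast
  qed
  show "hexmap z = hexmap w \<longleftrightarrow>
      (\<exists>\<zeta> l. \<zeta> ^ 3 = 1 \<and> l \<in> torus_lattice 1 omega \<and> w = \<zeta> * z + l)" for z w
  proof -
    have "hexmap w = hexmap z \<longleftrightarrow> hex1 w + hex2 w + hex3 w = hex1 z + hex2 z + hex3 z \<and>
       Im (vandermonde3 (hex1 w) (hex2 w) (hex3 w)) = Im (vandermonde3 (hex1 z) (hex2 z) (hex3 z))"
      unfolding hexmap_expand[of z] hexmap_eq_iff by simp
    also have "\<dots> \<longleftrightarrow> w - z \<in> torus_lattice 1 omega \<or> w - omega * z \<in> torus_lattice 1 omega \<or>
        w - omega\<^sup>2 * z \<in> torus_lattice 1 omega"
      unfolding unit_triple_eq_iff[OF hex_unit hex_unit] lattice_hex_iff power2_eq_square mult.assoc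
        hex_omega by auto
    also have "\<dots> \<longleftrightarrow> (\<exists>\<zeta>. \<zeta> ^ 3 = 1 \<and> w - \<zeta> * z \<in> torus_lattice 1 omega)"
      unfolding cube_root_unity_iff by auto
    also have "\<dots> \<longleftrightarrow> (\<exists>\<zeta> l. \<zeta> ^ 3 = 1 \<and> l \<in> torus_lattice 1 omega \<and> w = \<zeta> * z + l)"
      by (metis add_diff_cancel_left' add.commute diff_add_cancel)
    finally show ?thesis
      by auto
  qed
qed auto

lemma hexmap_minus: "hexmap (- z) = (- fst (hexmap z), snd (hexmap z))"
proof -
  have "vandermonde3 (cnj a) (cnj b) (cnj c) = cnj (vandermonde3 a b c)" for a b c
    by (simp add: vandermonde3_def)
  then show ?thesis
    by (simp add: hexmap_def Let_def hex_minus complex_eq_iff)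
qed

lemma orbit_map_hexmap_double: "orbit_map 1 omega 6 (\<lambda>z. angle_double (sgn (hexmap z))) (sphere 0 1)"
  using orbit_map_angle_double[OF orbit_map_hexmap, of "- 1"]
  by (simp add: hexmap_minus sgn_half_turn)

section \<open>Special points\<close>

context lattice_action
begin

definition same_orbit :: "complex \<Rightarrow> complex \<Rightarrow> bool" where
  "same_orbit z w \<longleftrightarrow> (\<exists>\<zeta> l. \<zeta> ^ m = 1 \<and> l \<in> torus_lattice 1 \<tau> \<and> w = \<zeta> * z + l)"

lemma same_orbitI: "\<zeta> ^ m = 1 \<Longrightarrow> w - \<zeta> * z \<in> torus_lattice 1 \<tau> \<Longrightarrow> same_orbit z w"
  unfolding same_orbit_def by (intro exI[of _ \<zeta>] exI[of _ "w - \<zeta> * z"]) simp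

lemma same_orbit_card_stab:
  assumes "same_orbit z w"
  shows "card (stab z) = card (stab w)"
proof -
  obtain \<zeta> l where w: "\<zeta> ^ m = 1" "l \<in> torus_lattice 1 \<tau>" "w = \<zeta> * z + l"
    using assms unfolding same_orbit_def by blast
  have \<zeta>: "inverse \<zeta> ^ m = 1" "\<zeta> \<noteq> 0"
    using w(1) root_nonzero by (auto simp: power_inverse)
  then have "- (inverse \<zeta> * l) \<in> torus_lattice 1 \<tau>"
    using rot w(2) torus_lattice_minus by blast
  moreover have "z = inverse \<zeta> * w + - (inverse \<zeta> * l)"
    using \<zeta>(2) by (simp add: w(3) algebra_simps)
  ultimately have "stab w \<subseteq> stab z"
    using stab_orbit_subset[OF \<zeta>(1)] by metis
  moreover have "stab z \<subseteq> stab w"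
    using stab_orbit_subset w by blast
  ultimately show ?thesis
    by (metis subset_antisym)
qed

text \<open>If all rotations stabilize z, its orbit is a single lattice coset; inequivalence of such
  points can thus be tested by the lattice.\<close>

lemma same_orbit_full:
  assumes "card (stab z) = m" "same_orbit z w"
  shows "w - z \<in> torus_lattice 1 \<tau>"
proof -
  obtain \<zeta> l where w: "\<zeta> ^ m = 1" "l \<in> torus_lattice 1 \<tau>" "w = \<zeta> * z + l"
    using assms unfolding same_orbit_def by blast
  then have "(\<zeta> - 1) * z \<in> torus_lattice 1 \<tau>"
    using stab_eq_roots[of z] assms(1) by (auto simp: stab_def)
  then have "(\<zeta> - 1) * z + l \<in> torus_lattice 1 \<tau>"
    using w torus_lattice_add by blast
  then show ?thesis
    using w by (simp add: algebra_simps)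
qed

lemma in_stab_iff: "\<zeta> \<in> stab c \<longleftrightarrow> \<zeta> ^ card (stab c) = 1"
  using stab_eq_roots by blast

text \<open>The stabilizer contains a primitive e-th root of unity, which must be an m-th root of
  unity.\<close>

lemma card_stab_dvd: "card (stab c) dvd m"
proof -
  define e where "e = card (stab c)"
  have e: "1 \<le> e"
    unfolding e_def by (rule card_stab_pos)
  have "cis (2 * pi * (1 / e)) ^ e = 1"
  proof -
    have "real e * (2 * pi * (1 / e)) = 2 * pi"
      using e by simp
    then show ?thesis
      by (simp only: Complex.DeMoivre cis_2pi)
  qed
  then have "cis (2 * pi * (1 / e)) ^ m = 1"
    using in_stab_iff[of "cis (2 * pi * (1 / e))" c] unfolding stab_def e_def by blast
  then have "cis (2 * pi * (real m / e)) = cis (2 * pi * 0)"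
  proof -
    have "real m * (2 * pi * (1 / e)) = 2 * pi * (real m / e)"
      by simp
    with \<open>cis (2 * pi * (1 / e)) ^ m = 1\<close> show ?thesis
      by (simp only: Complex.DeMoivre mult_zero_right cis_zero)
  qed
  then have "real m / real e \<in> \<int>"
    unfolding cis_2pi_eq_iff by simp
  then obtain i where "real m / real e = of_int i"
    by (auto elim: Ints_cases)
  then have "real_of_int (int m) = real_of_int (i * int e)"
    using e by (simp add: field_simps)
  then have "int m = i * int e"
    by (simp only: of_int_eq_iff)
  then show ?thesis
    by (metis dvd_triv_right e_def int_dvd_int_iff)
qed

text \<open>Phrases the branching data through orbits, so that the formula of F enters only through
  \<open>orbit_map\<close>.\<close>

lemma realizable_special_points:
  assumes F: "orbit_map 1 \<tau> m F (genus_surface g)" and k: "1 \<le> k" and C: "finite C"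
    and special: "\<And>c. c \<in> C \<Longrightarrow> 1 < card (stab c)"
    and complete: "\<And>z. 1 < card (stab z) \<Longrightarrow> \<exists>c\<in>C. same_orbit c z"
    and distinct: "\<And>c c'. c \<in> C \<Longrightarrow> c' \<in> C \<Longrightarrow> same_orbit c c' \<Longrightarrow> c = c'"
    and P: "P = image_mset (\<lambda>c. replicate_mset (k * m div card (stab c)) (card (stab c))) (mset_set C)"
  shows "realizable \<lparr>source_genus = 1, target_genus = g, cover_degree = k * m, partitions = P\<rparr>"
proof (rule realizable_orbit_map[OF F k C _ _ P])
  have F_eq: "F z = F w \<longleftrightarrow> same_orbit z w" for z w
    using orbit_map.fib[OF F] by (simp add: same_orbit_def)
  show "inj_on F C"
    using distinct by (auto simp: inj_on_def F_eq)
  show "F ` C = F ` {c. 1 < card (stab c)}"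
    using special complete F_eq by (auto simp: image_iff) metis
qed

end

text \<open>The case m = 1: without rotations all stabilizers are trivial, and the torus of the
  sublattice covers the torus of the full lattice.\<close>

lemma realizable_unbranched:
  assumes "1 \<le> k"
  shows "realizable \<lparr>source_genus = 1, target_genus = 1, cover_degree = k, partitions = {#}\<rparr>"
proof -
  interpret lattice_action \<i> 1
    by standard auto
  obtain E where E: "orbit_map 1 \<i> 1 E (genus_surface 1)"
    using torus_parametrization[of \<i> 1] by auto
  have one: "card (stab z) = 1" for z
    using card_stab_dvd[of z] by simp
  show ?thesis
    using realizable_special_points[OF E assms, of "{}" "{#}"] by (simp add: one)
qed

section \<open>Special points of the rotation groups of order 2, 4, 3 and 6\<close>

lemma coords_i: "coord1 \<i> z = Re z" "coord2 \<i> z = Im z"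
  by (simp_all add: coord1_def coord2_def)

lemma lattice_i_iff: "z \<in> torus_lattice 1 \<i> \<longleftrightarrow> Re z \<in> \<int> \<and> Im z \<in> \<int>"
  by (subst torus_lattice_iff_coords) (auto simp: coords_i)

lemma half_notin_Ints: "(1 / 2 :: real) \<notin> \<int>"
proof
  assume "(1 / 2 :: real) \<in> \<int>"
  then obtain n where "(1 / 2 :: real) = of_int n"
    by (auto elim: Ints_cases)
  then have "2 * n = 1"
    by linarith
  then show False
    by presburger
qed

lemma third_notin_Ints: "(1 / 3 :: real) \<notin> \<int>"
proof
  assume "(1 / 3 :: real) \<in> \<int>"
  then obtain n where "(1 / 3 :: real) = of_int n"
    by (auto elim: Ints_cases)
  then have "3 * n = 1"
    by linarith
  then show False
    by presburger
qed

lemma double_in_Ints: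
  assumes "2 * x \<in> \<int>"
  shows "x \<in> \<int> \<or> x - 1 / 2 \<in> (\<int> :: real set)"
proof -
  obtain n where n: "2 * x = of_int n"
    using assms by (auto elim: Ints_cases)
  show ?thesis
  proof (cases "even n")
    case True
    then obtain j where "n = 2 * j" by blast
    then have "x = of_int j" using n by simp
    then show ?thesis by simp
  next
    case False
    then obtain j where "n = 2 * j + 1" by (auto elim: oddE)
    then have "x - 1 / 2 = of_int j" using n by simp
    then show ?thesis by (metis Ints_of_int)
  qed
qed

lemma triple_in_Ints:
  assumes "3 * x \<in> \<int>"
  shows "x \<in> \<int> \<or> x - 1 / 3 \<in> \<int> \<or> x + 1 / 3 \<in> (\<int> :: real set)"
proof -
  obtain n where n: "3 * x = of_int n"
    using assms by (auto elim: Ints_cases)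
  define j where "j = n div 3"
  have "n = 3 * j \<or> n = 3 * j + 1 \<or> n = 3 * (j + 1) - 1"
    unfolding j_def by presburger
  then show ?thesis
  proof (elim disjE)
    assume "n = 3 * j"
    then have "x = of_int j" using n by simp
    then show ?thesis by simp
  next
    assume "n = 3 * j + 1"
    then have "x - 1 / 3 = of_int j" using n by simp
    then show ?thesis by (metis Ints_of_int)
  next
    assume "n = 3 * (j + 1) - 1"
    then have "x + 1 / 3 = of_int (j + 1)" using n by simp
    then show ?thesis by (metis Ints_of_int)
  qed
qed

lemma fourth_root_unity_iff: "z ^ 4 = 1 \<longleftrightarrow> z = 1 \<or> z = - 1 \<or> z = \<i> \<or> z = - \<i>"
proof -
  have eq: "z ^ 4 - 1 = (z - 1) * (z - (- 1)) * (z - \<i>) * (z - (- \<i>))"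
    using i_squared by (simp add: algebra_simps power4_eq_xxxx)
  have "z ^ 4 = 1 \<longleftrightarrow> z ^ 4 - 1 = 0"
    by simp
  then show ?thesis
    unfolding eq mult_eq_0_iff right_minus_eq by blast
qed

lemma sixth_root_unity_iff: "(z :: complex) ^ 6 = 1 \<longleftrightarrow> z ^ 3 = 1 \<or> (- z) ^ 3 = 1"
proof -
  have "z ^ 6 - 1 = (z ^ 3 - 1) * (z ^ 3 + 1)"
    by algebra
  moreover have "(- z) ^ 3 = 1 \<longleftrightarrow> z ^ 3 + 1 = 0"
  proof
    assume "(- z) ^ 3 = 1"
    then show "z ^ 3 + 1 = 0"
      by algebra
  next
    assume "z ^ 3 + 1 = 0"
    then show "(- z) ^ 3 = 1"
      by algebra
  qed
  ultimately show ?thesis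
    by auto
qed

lemma i_mult_lattice: "l \<in> torus_lattice 1 \<i> \<Longrightarrow> \<i> * l \<in> torus_lattice 1 \<i>"
  by (simp add: lattice_i_iff)

lemma omega_mult_lattice: "l \<in> torus_lattice 1 omega \<Longrightarrow> omega * l \<in> torus_lattice 1 omega"
  using torus_lattice_iff_coords[OF Im_omega, of 1] by (simp add: coords_omega_mult)

lemma cube_root_mult_lattice:
  assumes "\<zeta> ^ 3 = 1" "l \<in> torus_lattice 1 omega"
  shows "\<zeta> * l \<in> torus_lattice 1 omega"
  using assms omega_mult_lattice[of l] omega_mult_lattice[of "omega * l"]
  by (auto simp: cube_root_unity_iff power2_eq_square mult.assoc)

lemma lattice_action_2: "lattice_action \<i> 2"
  by standard (auto simp: power2_eq_1_iff)

lemma lattice_action_4: "lattice_action \<i> 4"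
  by standard (auto simp: fourth_root_unity_iff i_mult_lattice)

lemma lattice_action_3: "lattice_action omega 3"
  by standard (auto simp: cube_root_mult_lattice)

lemma lattice_action_6: "lattice_action omega 6"
proof
  fix \<zeta> l :: complex assume "\<zeta> ^ 6 = 1" "l \<in> torus_lattice 1 omega"
  then show "\<zeta> * l \<in> torus_lattice 1 omega"
    using cube_root_mult_lattice[of \<zeta> l] cube_root_mult_lattice[of "- \<zeta>" l]
    unfolding sixth_root_unity_iff by auto
qed auto

lemma minus_half_notin_Ints: "- (1 / 2 :: real) \<notin> \<int>"
  using half_notin_Ints Ints_minus by fastforce

lemma minus_third_notin_Ints: "- (1 / 3 :: real) \<notin> \<int>"
  using third_notin_Ints Ints_minus by fastforce

lemma two_thirds_notin_Ints: "(2 / 3 :: real) \<notin> \<int>" "- (2 / 3 :: real) \<notin> \<int>"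
proof -
  have "(2 / 3 :: real) = 1 - 1 / 3" "- (2 / 3 :: real) = 1 / 3 - 1"
    by simp_all
  moreover have "1 - 1 / 3 \<notin> (\<int> :: real set)" "1 / 3 - 1 \<notin> (\<int> :: real set)"
    using third_notin_Ints Ints_diff[of 1 "1 - 1 / 3 :: real"] Ints_add[of "1 / 3 - 1 :: real" 1]
    by auto
  ultimately show "(2 / 3 :: real) \<notin> \<int>" "- (2 / 3 :: real) \<notin> \<int>"
    by metis+
qed

lemmas nonintegers = half_notin_Ints minus_half_notin_Ints third_notin_Ints minus_third_notin_Ints
  two_thirds_notin_Ints

lemma card_stab_2:
  "card (lattice_action.stab \<i> 2 z) = (if 2 * z \<in> torus_lattice 1 \<i> then 2 else 1)"
proof -
  interpret lattice_action \<i> 2 by (rule lattice_action_2)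
  have "- 1 \<in> stab z \<longleftrightarrow> 2 * z \<in> torus_lattice 1 \<i>"
    using torus_lattice_minus_iff[of "2 * z" 1 \<i>] by (simp add: stab_def)
  moreover have "card (stab z) = 1 \<or> card (stab z) = 2"
    using card_stab_dvd[of z] prime_nat_iff two_is_prime_nat by blast
  ultimately show ?thesis
    using in_stab_iff[of "- 1" z] by (elim disjE) auto
qed

lemma realizable_2222:
  assumes "1 \<le> k"
  shows "realizable \<lparr>source_genus = 1, target_genus = 0, cover_degree = 2 * k, partitions =
       {#replicate_mset k 2, replicate_mset k 2, replicate_mset k 2, replicate_mset k 2#}\<rparr>"
proof -
  interpret lattice_action \<i> 2 by (rule lattice_action_2)
  \<comment> \<open>The half periods, which are the points fixed by negation modulo the
    lattice.\<close>
  define C where "C = {Complex 0 0, Complex (1 / 2) 0, Complex 0 (1 / 2), Complex (1 / 2) (1 / 2)}"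
  have card: "card (stab c) = 2" if "c \<in> C" for c
    using that by (auto simp: card_stab_2 C_def lattice_i_iff)
  have "realizable \<lparr>source_genus = 1, target_genus = 0, cover_degree = k * 2, partitions =
      image_mset (\<lambda>c. replicate_mset (k * 2 div card (stab c)) (card (stab c))) (mset_set C)\<rparr>"
  proof (rule realizable_special_points)
    show "orbit_map 1 \<i> 2 (\<lambda>z. sgn (pillow z)) (genus_surface 0)"
      unfolding genus_surface_0 by (rule orbit_map_pillow)
    show "\<exists>c\<in>C. same_orbit c z" if "1 < card (stab z)" for z
    proof -
      have "2 * z \<in> torus_lattice 1 \<i>"
        using that by (simp add: card_stab_2 split: if_splits)
      then have "2 * Re z \<in> \<int>" "2 * Im z \<in> \<int>"
        by (simp_all add: lattice_i_iff)
      then have "\<exists>c\<in>C. z - c \<in> torus_lattice 1 \<i>"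
        using double_in_Ints[of "Re z"] double_in_Ints[of "Im z"] by (auto simp: C_def lattice_i_iff)
      then show ?thesis
        using same_orbitI[of 1] by auto
    qed
    show "c = c'" if "c \<in> C" "c' \<in> C" "same_orbit c c'" for c c'
      using same_orbit_full[OF card[OF that(1)] that(3)] that(1,2)
      by (auto simp: C_def lattice_i_iff nonintegers)
  qed (use assms card in \<open>auto simp: C_def\<close>)
  also have "image_mset (\<lambda>c. replicate_mset (k * 2 div card (stab c)) (card (stab c))) (mset_set C) =
      image_mset (\<lambda>_. replicate_mset k 2) (mset_set C)"
    by (intro image_mset_cong) (auto simp: card C_def)
  also have "\<dots> = {#replicate_mset k 2, replicate_mset k 2, replicate_mset k 2, replicate_mset k 2#}"
    by (simp add: C_def)
  finally show ?thesis
    by (simp add: mult.commute)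
qed

lemma nat_dvd_4: "n dvd 4 \<Longrightarrow> n = 1 \<or> n = 2 \<or> n = (4::nat)"
  using dvd_imp_le[of n 4] by (cases "n = 0 \<or> n = 3") auto

lemma nat_dvd_6: "n dvd 6 \<Longrightarrow> n = 1 \<or> n = 2 \<or> n = 3 \<or> n = (6::nat)"
  using dvd_imp_le[of n 6] by (cases "n = 0 \<or> n = 4 \<or> n = 5") auto

text \<open>The stabilizer consists of all e-th roots of unity for a divisor e of 4, so membership
  of - 1 and \<i> determines e.\<close>

lemma card_stab_4:
  "card (lattice_action.stab \<i> 4 z) =
     (if (\<i> - 1) * z \<in> torus_lattice 1 \<i> then 4 else if 2 * z \<in> torus_lattice 1 \<i> then 2 else 1)"
proof -
  interpret lattice_action \<i> 4 by (rule lattice_action_4)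
  have "- 1 \<in> stab z \<longleftrightarrow> 2 * z \<in> torus_lattice 1 \<i>" "\<i> \<in> stab z \<longleftrightarrow> (\<i> - 1) * z \<in> torus_lattice 1 \<i>"
    using torus_lattice_minus_iff[of "2 * z" 1 \<i>] by (simp_all add: stab_def)
  moreover have "card (stab z) = 1 \<or> card (stab z) = 2 \<or> card (stab z) = 4"
    using card_stab_dvd[of z] by (rule nat_dvd_4)
  ultimately show ?thesis
    using in_stab_iff[of "- 1" z] in_stab_iff[of \<i> z] by (elim disjE) (auto simp: complex_eq_iff)
qed

lemma realizable_244:
  assumes "1 \<le> k"
  shows "realizable \<lparr>source_genus = 1, target_genus = 0, cover_degree = 4 * k, partitions =
       {#replicate_mset (2 * k) 2, replicate_mset k 4, replicate_mset k 4#}\<rparr>"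
proof -
  interpret lattice_action \<i> 4 by (rule lattice_action_4)
  \<comment> \<open>Corners and centres of the lattice squares have fourfold symmetry. The midpoints
    of the sides have only twofold symmetry and form one orbit, as \<i> exchanges r and the other
    midpoint.\<close>
  define p q r where "p = Complex 0 0" and "q = Complex (1 / 2) (1 / 2)" and "r = Complex (1 / 2) 0"
  have card: "card (stab p) = 4" "card (stab q) = 4" "card (stab r) = 2"
    by (simp_all add: card_stab_4 p_def q_def r_def lattice_i_iff nonintegers)
  have ne: "p \<noteq> q" "p \<noteq> r" "q \<noteq> r"
    by (simp_all add: p_def q_def r_def)
  have pq: "q - p \<notin> torus_lattice 1 \<i>" "p - q \<notin> torus_lattice 1 \<i>"
    by (simp_all add: p_def q_def lattice_i_iff nonintegers)
  have "realizable \<lparr>source_genus = 1, target_genus = 0, cover_degree = k * 4, partitions =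
      image_mset (\<lambda>c. replicate_mset (k * 4 div card (stab c)) (card (stab c))) (mset_set {p, q, r})\<rparr>"
  proof (rule realizable_special_points)
    show "orbit_map 1 \<i> 4 (\<lambda>z. angle_double (sgn (pillow z))) (genus_surface 0)"
      unfolding genus_surface_0 by (rule orbit_map_square)
    show "\<exists>c\<in>{p, q, r}. same_orbit c z" if z: "1 < card (stab z)" for z
    proof -
      \<comment> \<open>A nontrivial divisor of 4 is even, so special points are half
        periods.\<close>
      have "- 1 \<in> stab z"
        using in_stab_iff[of "- 1" z] nat_dvd_4[OF card_stab_dvd[of z]] z by auto
      then have "2 * z \<in> torus_lattice 1 \<i>"
        using torus_lattice_minus_iff[of "2 * z" 1 \<i>] by (simp add: stab_def)
      then have "2 * Re z \<in> \<int>" "2 * Im z \<in> \<int>"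
        by (simp_all add: lattice_i_iff)
      then have "z - p \<in> torus_lattice 1 \<i> \<or> z - q \<in> torus_lattice 1 \<i> \<or>
          z - r \<in> torus_lattice 1 \<i> \<or> z - \<i> * r \<in> torus_lattice 1 \<i>"
        using double_in_Ints[of "Re z"] double_in_Ints[of "Im z"]
        by (auto simp: p_def q_def r_def lattice_i_iff)
      then show ?thesis
        using same_orbitI[of 1] same_orbitI[of \<i>] by auto
    qed
    show "c = c'" if "c \<in> {p, q, r}" "c' \<in> {p, q, r}" "same_orbit c c'" for c c'
      using same_orbit_card_stab[OF that(3)] same_orbit_full[OF _ that(3)] that(1,2) card pq by auto
  qed (use assms card in auto)
  also have "image_mset (\<lambda>c. replicate_mset (k * 4 div card (stab c)) (card (stab c))) (mset_set {p, q, r}) =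
      {#replicate_mset (2 * k) 2, replicate_mset k 4, replicate_mset k 4#}"
    using ne by (simp add: card add_mset_commute mult.commute)
  finally show ?thesis
    by (simp add: mult.commute)
qed

definition hex_point :: "real \<Rightarrow> real \<Rightarrow> complex" where
  "hex_point x y = of_real x + of_real y * omega"

lemma coords_hex_point [simp]: "coord1 omega (hex_point x y) = x" "coord2 omega (hex_point x y) = y"
  unfolding hex_point_def by (rule coords_of_real[OF Im_omega])+

lemma lattice_omega_coords:
  "z \<in> torus_lattice 1 omega \<longleftrightarrow> coord1 omega z \<in> \<int> \<and> coord2 omega z \<in> \<int>"
  using torus_lattice_iff_coords[OF Im_omega, of 1] by simp

lemma coords_double: "coord1 \<tau> (2 * z) = 2 * coord1 \<tau> z" "coord2 \<tau> (2 * z) = 2 * coord2 \<tau> z"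
  by (simp_all add: coord1_def coord2_def)

lemma omega_fixed_iff:
  "(omega - 1) * z \<in> torus_lattice 1 omega \<longleftrightarrow>
     coord1 omega z + coord2 omega z \<in> \<int> \<and> coord1 omega z - 2 * coord2 omega z \<in> \<int>"
proof -
  define x y where "x = coord1 omega z" and "y = coord2 omega z"
  have "(omega - 1) * z = omega * z - z"
    by (simp add: algebra_simps)
  then have "coord1 omega ((omega - 1) * z) = - (x + y)" "coord2 omega ((omega - 1) * z) = x - 2 * y"
    by (simp_all add: coords_omega_mult x_def y_def)
  then show ?thesis
    unfolding lattice_omega_coords by (simp only: minus_in_Ints_iff x_def y_def)
qed

text \<open>Subtracting the two conditions makes 3 y integral, and y modulo 1 determines x modulo 1.
  The two nonzero classes are those of the centroids of the lattice triangles.\<close>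

lemma omega_fixed_points:
  assumes "(omega - 1) * z \<in> torus_lattice 1 omega"
  shows "z - hex_point 0 0 \<in> torus_lattice 1 omega \<or>
    z - hex_point (- 1 / 3) (1 / 3) \<in> torus_lattice 1 omega \<or>
    z - hex_point (1 / 3) (- 1 / 3) \<in> torus_lattice 1 omega"
proof -
  define x y where "x = coord1 omega z" and "y = coord2 omega z"
  have xy: "x + y \<in> \<int>" "x - 2 * y \<in> \<int>"
    using assms by (simp_all add: omega_fixed_iff x_def y_def)
  have "3 * y = (x + y) - (x - 2 * y)"
    by simp
  then have "3 * y \<in> \<int>"
    using xy Ints_diff by metis
  then consider "y \<in> \<int>" | "y - 1 / 3 \<in> \<int>" | "y + 1 / 3 \<in> \<int>"
    using triple_in_Ints by blast
  then show ?thesis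
  proof cases
    case 1
    then have "x \<in> \<int>"
      using Ints_diff[OF xy(1)] by fastforce
    then show ?thesis
      using 1 by (simp add: lattice_omega_coords x_def y_def)
  next
    case 2
    then have "x + 1 / 3 \<in> \<int>"
      using Ints_diff[OF xy(1) 2] by (simp add: algebra_simps)
    then show ?thesis
      using 2 by (simp add: lattice_omega_coords x_def y_def)
  next
    case 3
    then have "x - 1 / 3 \<in> \<int>"
      using Ints_diff[OF xy(1) 3] by (simp add: algebra_simps)
    then show ?thesis
      using 3 by (simp add: lattice_omega_coords x_def y_def)
  qed
qed

lemma omega_neq_1: "omega \<noteq> 1" "omega\<^sup>2 \<noteq> 1"
  by (simp_all add: omega_square) (simp_all add: omega_def complex_eq_iff)

lemma card_stab_3:
  "card (lattice_action.stab omega 3 z) = (if (omega - 1) * z \<in> torus_lattice 1 omega then 3 else 1)"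
proof -
  interpret lattice_action omega 3 by (rule lattice_action_3)
  have "omega \<in> stab z \<longleftrightarrow> (omega - 1) * z \<in> torus_lattice 1 omega"
    by (simp add: stab_def omega_cube)
  moreover have "card (stab z) = 1 \<or> card (stab z) = 3"
    using card_stab_dvd[of z] dvd_imp_le[of "card (stab z)" 3]
    by (cases "card (stab z) = 0 \<or> card (stab z) = 2") auto
  ultimately show ?thesis
    using in_stab_iff[of omega z] omega_neq_1 by (elim disjE) (auto simp: omega_cube)
qed

lemma realizable_333:
  assumes "1 \<le> k"
  shows "realizable \<lparr>source_genus = 1, target_genus = 0, cover_degree = 3 * k, partitions =
       {#replicate_mset k 3, replicate_mset k 3, replicate_mset k 3#}\<rparr>"
proof -
  interpret lattice_action omega 3 by (rule lattice_action_3)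
  define p q r where "p = hex_point 0 0" and "q = hex_point (- 1 / 3) (1 / 3)"
    and "r = hex_point (1 / 3) (- 1 / 3)"
  have card: "card (stab p) = 3" "card (stab q) = 3" "card (stab r) = 3"
    by (simp_all add: card_stab_3 p_def q_def r_def omega_fixed_iff)
  have lat: "p - q \<notin> torus_lattice 1 omega" "p - r \<notin> torus_lattice 1 omega"
    "q - r \<notin> torus_lattice 1 omega"
    by (simp_all add: p_def q_def r_def lattice_omega_coords nonintegers)
  then have lat': "q - p \<notin> torus_lattice 1 omega" "r - p \<notin> torus_lattice 1 omega"
    "r - q \<notin> torus_lattice 1 omega"
    using torus_lattice_minus[of _ 1 omega] by (metis minus_diff_eq)+
  have ne: "p \<noteq> q" "p \<noteq> r" "q \<noteq> r"
    using lat by auto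
  have "realizable \<lparr>source_genus = 1, target_genus = 0, cover_degree = k * 3, partitions =
      image_mset (\<lambda>c. replicate_mset (k * 3 div card (stab c)) (card (stab c))) (mset_set {p, q, r})\<rparr>"
  proof (rule realizable_special_points)
    show "orbit_map 1 omega 3 (\<lambda>z. sgn (hexmap z)) (genus_surface 0)"
      unfolding genus_surface_0 by (rule orbit_map_hexmap)
    show "\<exists>c\<in>{p, q, r}. same_orbit c z" if z: "1 < card (stab z)" for z
    proof -
      have "(omega - 1) * z \<in> torus_lattice 1 omega"
        using z by (simp add: card_stab_3 split: if_splits)
      from omega_fixed_points[OF this] show ?thesis
        using same_orbitI[of 1] by (auto simp: p_def q_def r_def)
    qed
    show "c = c'" if "c \<in> {p, q, r}" "c' \<in> {p, q, r}" "same_orbit c c'" for c c'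
      using same_orbit_full[OF _ that(3)] that(1,2) card lat lat' by auto
  qed (use assms card in auto)
  also have "image_mset (\<lambda>c. replicate_mset (k * 3 div card (stab c)) (card (stab c))) (mset_set {p, q, r}) =
      {#replicate_mset k 3, replicate_mset k 3, replicate_mset k 3#}"
    using ne by (simp add: card)
  finally show ?thesis
    by (simp add: mult.commute)
qed

text \<open>Since e divides 6, its prime factors 2 and 3 are detected independently by - 1 and
  omega.\<close>

lemma card_stab_6:
  "card (lattice_action.stab omega 6 z) =
     (if 2 * z \<in> torus_lattice 1 omega then 2 else 1) *
     (if (omega - 1) * z \<in> torus_lattice 1 omega then 3 else 1)"
proof -
  interpret lattice_action omega 6 by (rule lattice_action_6)
  have "omega ^ 6 = (omega ^ 3)\<^sup>2"
    by (simp flip: power_mult)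
  then have o6: "omega ^ 6 = 1"
    by (simp add: omega_cube)
  have "- 1 \<in> stab z \<longleftrightarrow> 2 * z \<in> torus_lattice 1 omega"
    "omega \<in> stab z \<longleftrightarrow> (omega - 1) * z \<in> torus_lattice 1 omega"
    using torus_lattice_minus_iff[of "2 * z" 1 omega] by (simp_all add: stab_def o6)
  moreover have "card (stab z) = 1 \<or> card (stab z) = 2 \<or> card (stab z) = 3 \<or> card (stab z) = 6"
    using card_stab_dvd[of z] by (rule nat_dvd_6)
  ultimately show ?thesis
    using in_stab_iff[of "- 1" z] in_stab_iff[of omega z] omega_neq_1
    by (elim disjE) (auto simp: omega_cube o6)
qed

lemma realizable_236:
  assumes "1 \<le> k"
  shows "realizable \<lparr>source_genus = 1, target_genus = 0, cover_degree = 6 * k, partitions =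
       {#replicate_mset (3 * k) 2, replicate_mset (2 * k) 3, replicate_mset k 6#}\<rparr>"
proof -
  interpret lattice_action omega 6 by (rule lattice_action_6)
  \<comment> \<open>Negation exchanges the two classes of centroids, leaving q; multiplication by
    omega permutes the three nonzero half periods modulo the lattice, leaving r.\<close>
  define p q r where "p = hex_point 0 0" and "q = hex_point (- 1 / 3) (1 / 3)"
    and "r = hex_point (1 / 2) 0"
  have card: "card (stab p) = 6" "card (stab q) = 3" "card (stab r) = 2"
    unfolding card_stab_6 omega_fixed_iff unfolding lattice_omega_coords coords_double p_def q_def r_def
    by (simp_all add: nonintegers)
  have ne: "p \<noteq> q" "p \<noteq> r" "q \<noteq> r"
    using card by auto
  have "realizable \<lparr>source_genus = 1, target_genus = 0, cover_degree = k * 6, partitions =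
      image_mset (\<lambda>c. replicate_mset (k * 6 div card (stab c)) (card (stab c))) (mset_set {p, q, r})\<rparr>"
  proof (rule realizable_special_points)
    show "orbit_map 1 omega 6 (\<lambda>z. angle_double (sgn (hexmap z))) (genus_surface 0)"
      unfolding genus_surface_0 by (rule orbit_map_hexmap_double)
    show "\<exists>c\<in>{p, q, r}. same_orbit c z" if z: "1 < card (stab z)" for z
    proof -
      consider "2 * z \<in> torus_lattice 1 omega" | "(omega - 1) * z \<in> torus_lattice 1 omega"
        using z by (auto simp: card_stab_6 split: if_splits)
      then show ?thesis
      proof cases
        case 1
        define x y where "x = coord1 omega z" and "y = coord2 omega z"
        have "2 * x \<in> \<int>" "2 * y \<in> \<int>"
          using 1 by (simp_all add: lattice_omega_coords coords_double x_def y_def)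
        then consider "x \<in> \<int>" "y \<in> \<int>" | "x - 1 / 2 \<in> \<int>" "y \<in> \<int>"
          | "x \<in> \<int>" "y - 1 / 2 \<in> \<int>" | "x - 1 / 2 \<in> \<int>" "y - 1 / 2 \<in> \<int>"
          using double_in_Ints by blast
        then show ?thesis
        proof cases
          case 1
          then have "same_orbit p z"
            by (intro same_orbitI[of 1]) (simp_all add: p_def lattice_omega_coords x_def y_def)
          then show ?thesis by blast
        next
          case 2
          then have "same_orbit r z"
            by (intro same_orbitI[of 1]) (simp_all add: r_def lattice_omega_coords x_def y_def)
          then show ?thesis by blast
        next
          case 3
          then have "same_orbit r z"
            by (intro same_orbitI[of omega])
              (simp_all add: r_def lattice_omega_coords coords_omega_mult x_def y_def
                sixth_root_unity_iff omega_cube)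
          then show ?thesis by blast
        next
          case 4
          \<comment> \<open>Both coordinates of \<open>omega\<^sup>2 * r\<close> are - 1 / 2, hence
            the shift by 1.\<close>
          have "x + 1 / 2 \<in> \<int>" "y + 1 / 2 \<in> \<int>"
            using Ints_add[OF 4(1), of 1] Ints_add[OF 4(2), of 1] by (simp_all add: add.commute)
          then have "z - omega\<^sup>2 * r \<in> torus_lattice 1 omega"
            by (simp add: r_def lattice_omega_coords coords_omega_mult x_def y_def power2_eq_square mult.assoc)
          then have "same_orbit r z"
            using cube_root_unity_iff sixth_root_unity_iff by (intro same_orbitI[of "omega\<^sup>2"]) blast+
          then show ?thesis by blast
        qed
      next
        case 2
        have "same_orbit q z" if "z - hex_point (1 / 3) (- 1 / 3) \<in> torus_lattice 1 omega"
        proof (rule same_orbitI[of "- 1"])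
          show "z - - 1 * q \<in> torus_lattice 1 omega"
            using that by (simp add: q_def hex_point_def)
        qed simp
        then show ?thesis
          using omega_fixed_points[OF 2] same_orbitI[of 1] by (auto simp: p_def q_def)
      qed
    qed
    \<comment> \<open>The stabilizer orders 6, 3 and 2 already separate the three orbits.\<close>
    show "c = c'" if "c \<in> {p, q, r}" "c' \<in> {p, q, r}" "same_orbit c c'" for c c'
      using same_orbit_card_stab[OF that(3)] that(1,2) card by auto
  qed (use assms card in auto)
  also have "image_mset (\<lambda>c. replicate_mset (k * 6 div card (stab c)) (card (stab c))) (mset_set {p, q, r}) =
      {#replicate_mset (3 * k) 2, replicate_mset (2 * k) 3, replicate_mset k 6#}"
  proof -
    have "k * 6 div 2 = 3 * k" "k * 6 div 3 = 2 * k"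
      by simp_all
    then show ?thesis
      using ne by (simp add: card add_mset_commute)
  qed
  finally show ?thesis
    by (simp add: mult.commute)
qed

theorem theorem3p2:
  shows "{c. candidate_branched_cover c \<and>
             (\<exists>X. induced_orbifold_cover c = (torus_orbifold, X))} = torus_covers \<and>
         (\<forall>c\<in>torus_covers. realizable c)"
proof (intro conjI ballI equalityI subsetI)
  fix c assume "c \<in> {c. candidate_branched_cover c \<and>
             (\<exists>X. induced_orbifold_cover c = (torus_orbifold, X))}"
  then show "c \<in> torus_covers"
    using torus_cover_classification by (auto simp: induced_orbifold_cover_def)
next
  fix c assume "c \<in> torus_covers"
  then show "c \<in> {c. candidate_branched_cover c \<and>
             (\<exists>X. induced_orbifold_cover c = (torus_orbifold, X))}"
    using torus_covers_candidates by (auto simp: induced_orbifold_cover_def)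
next
  fix c assume "c \<in> torus_covers"
  then show "realizable c"
    unfolding torus_covers_def using realizable_unbranched realizable_2222 realizable_333
      realizable_244 realizable_236 by auto
qed

end
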